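(* Let $u \in C^2(B_1)$ be a plurisubharmonic function that solves the equation $$\det(u_{\bar k j}) = f \quad \text{in } B_1 .$$ Suppose $$\inf_{B_1} f^{1/n} \ge \lambda > 0 \quad\text{and}\quad \sup_{B_1}\Delta u \le \Lambda .$$ Then there exists a concave function $\widetilde F : \mathrm{Sym}(2n) \to \mathbb{R}$ such that: i) $\widetilde F$ is $\theta$-uniformly elliptic, i.e. $$\theta \|P\| \le \widetilde F(M+P) - \widetilde F(M) \le \theta^{-1}\|P\| \qquad \text{for all } M \in \mathrm{Sym}(2n) \text{ and all } P\in \mathrm{Sym}(2n) \text{ with } P \ge 0,$$ where $\theta>0$ depends only on $\lambda,\Lambda,n$; ii) $u$ satisfies the equation $$\widetilde F(D^2 u) = f^{1/n} \quad \text{in } B_1 .$$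
   Context: Here $n\ge 1$ is an integer, $B_1$ denotes the open unit ball centered at the origin in $\mathbb{C}^n\cong\mathbb{R}^{2n}$, $u$ is real-valued, $f$ is a real-valued function on $B_1$, and $\lambda,\Lambda$ are real constants. $(u_{\bar k j})$ is the $n\times n$ complex Hessian matrix $\left(\frac{\partial^2 u}{\partial z_j\,\partial \bar z_k}\right)$, and $\det$ is its complex determinant. $\Delta u$ is the Laplacian of $u$ on $\mathbb{R}^{2n}$, and $D^2u$ is the real $2n\times 2n$ Hessian matrix of $u$ viewed as a function on a domain of $\mathbb{R}^{2n}$. $\mathrm{Sym}(2n)$ is the space of $2n\times 2n$ real symmetric matrices, $P\ge 0$ means that $P$ is positive semidefinite, and $\|\cdot\|$ is the standard matrix (operator) norm. *)

theory Defs
  imports "HOL-Analysis.Analysis"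
begin

text \<open>
  The identification of \<open>\<complex>\<^sup>n\<close> with \<open>\<real>\<^sup>2\<^sup>n\<close>: real coordinates are indexed by
  \<^typ>\<open>'n + 'n\<close>, with \<open>Inl j\<close> for \<open>x\<^sub>j\<close> and \<open>Inr j\<close> for \<open>y\<^sub>j\<close>,
  where \<open>z\<^sub>j = x\<^sub>j + \<i> y\<^sub>j\<close>.
\<close>

definition real_coord :: "'n + 'n \<Rightarrow> complex ^ 'n::finite" where
  "real_coord a = (case a of Inl j \<Rightarrow> axis j 1 | Inr j \<Rightarrow> axis j \<i>)"

definition partial ::
  "'n + 'n \<Rightarrow> (complex ^ 'n::finite \<Rightarrow> 'b::real_normed_vector) \<Rightarrow> complex ^ 'n \<Rightarrow> 'b" where
  "partial a g z = frechet_derivative g (at z) (real_coord a)"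

text \<open>Meant for open \<open>S\<close>.\<close>

definition C2_on :: "(complex ^ 'n::finite) set \<Rightarrow> (complex ^ 'n \<Rightarrow> real) \<Rightarrow> bool" where
  "C2_on S u \<longleftrightarrow>
     (\<forall>z\<in>S. u differentiable (at z)) \<and>
     (\<forall>a. \<forall>z\<in>S. partial a u differentiable (at z)) \<and>
     (\<forall>a b. continuous_on S (partial b (partial a u)))"

definition real_hessian ::
  "(complex ^ 'n::finite \<Rightarrow> real) \<Rightarrow> complex ^ 'n \<Rightarrow> real ^ ('n + 'n) ^ ('n + 'n)" where
  "real_hessian u z = (\<chi> a b. partial a (partial b u) z)"

definition laplacian :: "(complex ^ 'n::finite \<Rightarrow> real) \<Rightarrow> complex ^ 'n \<Rightarrow> real" where
  "laplacian u z = (\<Sum>a\<in>UNIV. partial a (partial a u) z)"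

definition d_z :: "'n \<Rightarrow> (complex ^ 'n::finite \<Rightarrow> complex) \<Rightarrow> complex ^ 'n \<Rightarrow> complex" where
  "d_z j g z = (partial (Inl j) g z - \<i> * partial (Inr j) g z) / 2"

definition d_zbar :: "'n \<Rightarrow> (complex ^ 'n::finite \<Rightarrow> complex) \<Rightarrow> complex ^ 'n \<Rightarrow> complex" where
  "d_zbar j g z = (partial (Inl j) g z + \<i> * partial (Inr j) g z) / 2"

definition complex_hessian ::
  "(complex ^ 'n::finite \<Rightarrow> real) \<Rightarrow> complex ^ 'n \<Rightarrow> complex ^ 'n ^ 'n" where
  "complex_hessian u z = (\<chi> k j. d_z j (d_zbar k (\<lambda>w. complex_of_real (u w))) z)"

definition upper_semicontinuous_on :: "'a::topological_space set \<Rightarrow> ('a \<Rightarrow> real) \<Rightarrow> bool" where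
  "upper_semicontinuous_on S u \<longleftrightarrow>
     (\<forall>z\<in>S. \<forall>c > u z. eventually (\<lambda>w. u w < c) (at z within S))"

text \<open>
  Plurisubharmonicity of a real-valued function on an open set: upper semicontinuity and the
  sub-mean value inequality on every closed disc \<open>{a + \<zeta> b | \<bar>\<zeta>\<bar> \<le> 1}\<close> contained in the set.
  An upper semicontinuous function is bounded above on the boundary circle, so its mean there is
  either finite or \<open>-\<infinity>\<close>; since \<open>u a\<close> is real, the inequality rules out the latter.
  This is the integrability conjunct, needed because the library integral of a
  non-integrable function is 0.
\<close>

definition plurisubharmonic_on ::
  "(complex ^ 'n::finite) set \<Rightarrow> (complex ^ 'n \<Rightarrow> real) \<Rightarrow> bool" where
  "plurisubharmonic_on S u \<longleftrightarrow>
     upper_semicontinuous_on S u \<and>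
     (\<forall>a b. (\<forall>\<zeta>. norm \<zeta> \<le> 1 \<longrightarrow> a + \<zeta> *s b \<in> S) \<longrightarrow>
        (\<lambda>t. u (a + cis t *s b)) absolutely_integrable_on {0..2 * pi} \<and>
        u a \<le> (1 / (2 * pi)) * integral {0..2 * pi} (\<lambda>t. u (a + cis t *s b)))"

definition Sym :: "(real ^ 'm ^ 'm::finite) set" where
  "Sym = {M. transpose M = M}"

definition pos_semidef :: "real ^ 'm ^ 'm::finite \<Rightarrow> bool" where
  "pos_semidef P \<longleftrightarrow> (\<forall>x. 0 \<le> x \<bullet> (P *v x))"

text \<open>
  The matrix norm is the operator norm; \<^const>\<open>norm\<close> on \<^typ>\<open>real ^ 'm ^ 'm\<close> would be
  the Frobenius norm.
\<close>

definition uniformly_elliptic :: "real \<Rightarrow> (real ^ 'm ^ 'm::finite \<Rightarrow> real) \<Rightarrow> bool" where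
  "uniformly_elliptic \<theta> F \<longleftrightarrow>
     (\<forall>M\<in>Sym. \<forall>P\<in>Sym. pos_semidef P \<longrightarrow>
        \<theta> * onorm ((*v) P) \<le> F (M + P) - F M \<and>
        F (M + P) - F M \<le> inverse \<theta> * onorm ((*v) P))"

end

theory Submission
  imports Defs "Jordan_Normal_Form.Schur_Decomposition"
begin

text \<open>
  Write \<open>H(M)\<close> for the complex Hermitian matrix determined by a real symmetric matrix \<open>M\<close> of twice
  the size, so that \<open>H(D\<^sup>2u)\<close> is the complex Hessian (\<open>complex_hessian_eq\<close>).  On positive definite
  Hermitian matrices \<open>det\<^sup>1\<^sup>/\<^sup>n\<close> is concave and homogeneous of degree one, hence equal to the infimum
  of its own linearizations: by the inequality between the arithmetic and geometric means of the
  eigenvalues of \<open>A\<inverse>K\<close>,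

    \<open>det(K)\<^sup>1\<^sup>/\<^sup>n \<le> (1/n) det(A)\<^sup>1\<^sup>/\<^sup>n tr(A\<inverse>K)\<close>, with equality for \<open>K = A\<close>

  (\<open>root_det_le_linearization\<close>, \<open>linearization_self\<close>).  Let \<open>L\<^sub>z(M)\<close> be the right-hand side
  for \<open>A = H(D\<^sup>2u(z))\<close> and \<open>K = H(M)\<close>.  The function \<open>F(M) = inf\<^sub>z L\<^sub>z(M)\<close>, with \<open>z\<close> ranging over the
  ball, is concave as an infimum of linear functions, and at \<open>M = D\<^sup>2u(w)\<close> the infimum is attained at
  \<open>z = w\<close>, with the value \<open>f(w)\<^sup>1\<^sup>/\<^sup>n\<close>.

  Uniform ellipticity passes from linear functions to their infimum (\<open>infimum_of_linear_elliptic\<close>),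
  so only each \<open>L\<^sub>z\<close> has to be estimated, with constants independent of \<open>z\<close>.  Plurisubharmonicity
  makes \<open>A = H(D\<^sup>2u(z))\<close> positive semidefinite (\<open>plurisubharmonic_imp_psd\<close>), the bound on the Laplacian
  bounds its trace by some \<open>T\<close>, and the lower bound on \<open>f\<close> bounds its determinant from below by
  \<open>\<lambda>\<^sup>n\<close>.  Thus \<open>A\<close> has eigenvalues at most \<open>T\<close>, which gives \<open>A\<inverse> \<ge> 1/T\<close>, and since the
  eigenvalues of \<open>T A\<inverse>\<close> are at least \<open>1\<close> and have product \<open>T\<^sup>n / det A\<close>, none of them
  exceeds that product, which bounds \<open>A\<inverse>\<close> from above.  Consequently \<open>L\<^sub>z(P)\<close> is comparable to
  \<open>tr H(P) = tr(P)/4\<close> for positive semidefinite \<open>P\<close> (\<open>linearization_ge_trace\<close>,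
  \<open>linearization_le_trace\<close>), and \<open>tr P\<close> is comparable to the operator norm of \<open>P\<close>.

  All spectral information is drawn from one fact: the product of two positive semidefinite
  matrices has nonnegative real eigenvalues (\<open>psd_mult_eigenvalue\<close>), whose sum is its trace and
  whose product is its determinant.
\<close>

section \<open>Eigenvalues of a complex matrix indexed by a finite type\<close>

text \<open>
  By the Schur decomposition the matrix is similar to a triangular one, whose diagonal consists of
  the roots of the characteristic polynomial; trace and determinant are invariant under similarity.
\<close>

lemma triangular_eigenvalues:
  fixes A :: "complex Matrix.mat"
  assumes A: "A \<in> carrier_mat n n"
  obtains es where "length es = n" "Determinant.det A = prod_list es"
    "(\<Sum>i<n. A $$ (i, i)) = sum_list es" "\<And>e. e \<in> set es \<Longrightarrow> eigenvalue A e"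
proof -
  obtain es where es: "char_poly A = (\<Prod>a\<leftarrow>es. [:- a, 1:])" "length es = n"
    using char_poly_factorized[OF A] by blast
  obtain B P Q where BPQ: "schur_decomposition A es = (B, P, Q)"
    by (cases "schur_decomposition A es")
  from schur_decomposition[OF A es(1) BPQ]
  have sim: "similar_mat_wit A B P Q" and ut: "upper_triangular B" and dg: "diag_mat B = es"
    by auto
  from similar_mat_witD2[OF A sim]
  have c: "B \<in> carrier_mat n n" "P \<in> carrier_mat n n" "Q \<in> carrier_mat n n"
    and QP: "Q * P = 1\<^sub>m n" and AB: "A = P * B * Q" by auto
  have "Determinant.det A = Determinant.det B"
    using sim by (intro det_similar) (auto simp: similar_mat_def)
  also have "\<dots> = prod_list es" using det_upper_triangular[OF ut c(1)] dg by simp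
  finally have d: "Determinant.det A = prod_list es" .
  have tr_comm: "(\<Sum>i<n. (X * Y) $$ (i, i)) = (\<Sum>i<n. (Y * X) $$ (i, i))"
    if "X \<in> carrier_mat n n" "Y \<in> carrier_mat n n" for X Y :: "complex Matrix.mat"
  proof -
    have "(\<Sum>i<n. (X * Y) $$ (i, i)) = (\<Sum>i<n. \<Sum>j<n. X $$ (i, j) * Y $$ (j, i))"
      using that by (auto simp: scalar_prod_def lessThan_atLeast0 intro!: sum.cong)
    also have "\<dots> = (\<Sum>j<n. \<Sum>i<n. X $$ (i, j) * Y $$ (j, i))" by (rule sum.swap)
    also have "\<dots> = (\<Sum>i<n. (Y * X) $$ (i, i))"
      using that by (auto simp: scalar_prod_def lessThan_atLeast0 mult.commute intro!: sum.cong)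
    finally show ?thesis .
  qed
  have "(\<Sum>i<n. A $$ (i, i)) = (\<Sum>i<n. (Q * (P * B)) $$ (i, i))"
    using c unfolding AB by (intro tr_comm) auto
  also have "Q * (P * B) = B"
    using c QP by (metis assoc_mult_mat left_mult_one_mat)
  also have "(\<Sum>i<n. B $$ (i, i)) = sum_list (diag_mat B)"
    using c by (simp add: diag_mat_def sum_list_distinct_conv_sum_set lessThan_atLeast0)
  finally have t: "(\<Sum>i<n. A $$ (i, i)) = sum_list es" using dg by simp
  have ev: "eigenvalue A e" if "e \<in> set es" for e
    unfolding eigenvalue_root_char_poly[OF A] es(1) poly_prod_list
    using that by (auto simp: prod_list_zero_iff image_iff)
  from that es(2) d t ev show ?thesis by blast
qed

\<comment> \<open>From here on, matrices, vectors and determinants are those over finite index types.\<close>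
hide_const (open) Determinant.det Matrix.mat
hide_fact (open) Matrix.vec_eq_iff Matrix.mat_def
no_notation vec_index (infixl "$" 100) and scalar_prod (infix "\<bullet>" 70)

text \<open>
  An enumeration of the index type carries the matrix to one indexed by numbers.  Trace, eigenvectors
  and the Leibniz expansion of the determinant are all independent of the enumeration.
\<close>

lemma eigenvalue_list:
  fixes A :: "complex ^ 'n ^ 'n"
  obtains es where "length es = CARD('n)" "det A = prod_list es" "trace A = sum_list es"
    "\<And>e. e \<in> set es \<Longrightarrow> \<exists>v. v \<noteq> 0 \<and> A *v v = e *s v"
proof -
  let ?n = "CARD('n)"
  obtain g :: "nat \<Rightarrow> 'n" where g: "bij_betw g {0..<?n} UNIV"
    using ex_bij_betw_nat_finite[of "UNIV :: 'n set"] by auto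
  obtain h :: "'n \<Rightarrow> nat" where h: "bij_betw h UNIV {0..<?n}" 
    and hg: "\<And>i. i < ?n \<Longrightarrow> h (g i) = i" and gh: "\<And>k. g (h k) = k"
    using bij_betw_inv_into[OF g] g
    by (metis UNIV_I atLeast0LessThan bij_betw_inv_into_left bij_betw_inv_into_right lessThan_iff)
  have hlt: "h k < ?n" for k using h by (auto simp: bij_betw_def)
  define B where "B = Matrix.mat ?n ?n (\<lambda>(i, j). A $ g i $ g j)"
  have B: "B \<in> carrier_mat ?n ?n" by (simp add: B_def)
  obtain es where es: "length es = ?n" "Determinant.det B = prod_list es"
    "(\<Sum>i<?n. B $$ (i, i)) = sum_list es" "\<And>e. e \<in> set es \<Longrightarrow> eigenvalue B e"
    using triangular_eigenvalues[OF B] by blast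
  have "sum_list es = (\<Sum>i\<in>{0..<?n}. A $ g i $ g i)"
    by (simp add: es(3)[symmetric] B_def lessThan_atLeast0)
  also have "\<dots> = trace A"
    unfolding Determinants.trace_def by (rule sum.reindex_bij_betw[OF g])
  finally have tr: "trace A = sum_list es" by simp
  have "det A = (\<Sum>p | p permutes (UNIV :: 'n set). of_int (sign p) * (\<Prod>k\<in>UNIV. A $ k $ p k))"
    by (simp add: Determinants.det_def)
  also have "\<dots> = (\<Sum>q | q permutes {0..<?n}. signof q * (\<Prod>i\<in>{0..<?n}. B $$ (i, q i)))"
  proof (rule sum.reindex_bij_betw[symmetric, THEN trans, OF bij_betw_permutations[OF g]], rule sum.cong[OF refl])
    fix q assume "q \<in> {q. q permutes {0..<?n}}"
    then have q: "q permutes {0..<?n}" by simp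
    define p where "p = (\<lambda>x. if x \<in> UNIV then g (q (inv_into {0..<?n} g x)) else x)"
    have inv_g: "inv_into {0..<?n} g (g i) = i" if "i < ?n" for i
      using g that by (auto simp: bij_betw_def)
    interpret permutes_bij_finite q "{0..<?n}" UNIV g "inv_into {0..<?n} g" p
      by unfold_locales (use q g inv_g in \<open>auto simp: p_def\<close>)
    have "(\<Prod>k\<in>UNIV. A $ k $ p k) = (\<Prod>i\<in>{0..<?n}. A $ g i $ p (g i))"
      by (rule prod.reindex_bij_betw[OF g, symmetric])
    also have "\<dots> = (\<Prod>i\<in>{0..<?n}. B $$ (i, q i))"
      using permutes_in_image[OF q] by (intro prod.cong) (auto simp: B_def p_def inv_g)
    finally show "of_int (sign p) * (\<Prod>k\<in>UNIV. A $ k $ p k) = signof q * (\<Prod>i\<in>{0..<?n}. B $$ (i, q i))"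
      using sign_p' by (simp add: sign_def)
  qed
  also have "\<dots> = prod_list es" using det_def'[OF B] es(2) by simp
  finally have dt: "det A = prod_list es" .
  have ev: "\<exists>v. v \<noteq> 0 \<and> A *v v = e *s v" if "e \<in> set es" for e
  proof -
    from es(4)[OF that] obtain w where w: "w \<in> carrier_vec ?n" "w \<noteq> 0\<^sub>v ?n" "B *\<^sub>v w = e \<cdot>\<^sub>v w"
      unfolding eigenvalue_def eigenvector_def using B by auto
    define v :: "complex ^ 'n" where "v = (\<chi> k. vec_index w (h k))"
    have "(A *v v) $ k = (e *s v) $ k" for k
    proof -
      have "e * vec_index w (h k) = vec_index (B *\<^sub>v w) (h k)"
        using w hlt by simp
      also have "\<dots> = (\<Sum>i\<in>{0..<?n}. A $ k $ g i * vec_index w i)"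
        using w(1) hlt by (simp add: B_def scalar_prod_def gh)
      also have "\<dots> = (\<Sum>i\<in>{0..<?n}. A $ k $ g i * v $ g i)"
        by (rule sum.cong) (auto simp: v_def hg)
      also have "\<dots> = (A *v v) $ k"
        unfolding matrix_vector_mult_def by (simp add: sum.reindex_bij_betw[OF g, where g="\<lambda>j. A $ k $ j * v $ j"])
      finally show ?thesis by (simp add: v_def)
    qed
    moreover have "v \<noteq> 0"
    proof
      assume "v = 0"
      then have "vec_index w (h (g i)) = 0" for i by (metis v_def vec_lambda_beta zero_index)
      then have "vec_index w i = 0" if "i < ?n" for i using hg[OF that] by metis
      then have "w = 0\<^sub>v ?n" using w(1) by (intro eq_vecI) auto
      with w(2) show False by simp
    qed
    ultimately show ?thesis by (metis Finite_Cartesian_Product.vec_eq_iff)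
  qed
  from that es(1) dt tr ev show ?thesis by blast
qed

section \<open>Positive semidefinite Hermitian matrices\<close>

definition hinner :: "complex ^ 'n \<Rightarrow> complex ^ 'n \<Rightarrow> complex" where
  "hinner x y = (\<Sum>i\<in>UNIV. cnj (x $ i) * y $ i)"

lemma hinner_add_right: "hinner x (y + z) = hinner x y + hinner x z"
  and hinner_add_left: "hinner (x + y) z = hinner x z + hinner y z"
  and hinner_diff_right: "hinner x (y - z) = hinner x y - hinner x z"
  and hinner_diff_left: "hinner (x - y) z = hinner x z - hinner y z"
  and hinner_scale_right: "hinner x (c *s y) = c * hinner x y"
  and hinner_scale_left: "hinner (c *s x) y = cnj c * hinner x y"
  by (simp_all add: hinner_def sum.distrib sum_subtractf sum_distrib_left algebra_simps)

lemmas hinner_simps = hinner_add_right hinner_add_left hinner_diff_right hinner_diff_left hinner_scale_right hinner_scale_left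

lemma hinner_commute: "hinner x y = cnj (hinner y x)"
  by (simp add: hinner_def mult.commute)

lemma hinner_self: "hinner x x = of_real ((norm x)\<^sup>2)"
  by (simp add: hinner_def norm_vec_def L2_set_def sum_nonneg complex_norm_square mult.commute flip: of_real_power)

lemma norm_hinner_le: "norm (hinner x y) \<le> norm x * norm y"
proof -
  have "norm (hinner x y) \<le> (\<Sum>i\<in>UNIV. \<bar>norm (x $ i)\<bar> * \<bar>norm (y $ i)\<bar>)"
    unfolding hinner_def by (rule order_trans[OF norm_sum]) (simp add: norm_mult)
  also have "\<dots> \<le> norm x * norm y"
    unfolding norm_vec_def by (rule L2_set_mult_ineq)
  finally show ?thesis .
qed

text \<open>
  Over the complex numbers a form with real values is automatically Hermitian, so this condition
  includes that the matrix is Hermitian; see \<open>psd_hermitian\<close>.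
\<close>

definition psd :: "complex ^ 'n ^ 'n \<Rightarrow> bool" where
  "psd A \<longleftrightarrow> (\<forall>x. hinner x (A *v x) \<in> \<real>\<^sub>\<ge>\<^sub>0)"

lemma psdD: "psd A \<Longrightarrow> 0 \<le> Re (hinner x (A *v x))" "psd A \<Longrightarrow> Im (hinner x (A *v x)) = 0"
  by (auto simp: psd_def complex_nonneg_Reals_iff)

lemma psd_form_eq_Re: "psd A \<Longrightarrow> hinner x (A *v x) = of_real (Re (hinner x (A *v x)))"
  by (simp add: complex_eq_iff psdD)

text \<open>
  Polarization: the values of the form at \<open>x + y\<close> and at \<open>x + \<i>y\<close> are real.
\<close>

lemma psd_hermitian:
  assumes "psd A"
  shows "hinner x (A *v y) = cnj (hinner y (A *v x))"
proof -
  have "Im (hinner (x + y) (A *v (x + y))) = 0" "Im (hinner (x + \<i> *s y) (A *v (x + \<i> *s y))) = 0"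
    using psdD(2)[OF assms] by blast+
  then show ?thesis
    using psdD(2)[OF assms, of x] psdD(2)[OF assms, of y]
    by (simp add: matrix_vector_right_distrib vector_scalar_commute hinner_simps complex_eq_iff)
qed

text \<open>
  The right-hand side is the value of the form at \<open>x - s Ax\<close>.  Choosing \<open>s\<close> well yields both
  \<open>A\<^sup>2 \<le> t A\<close> when \<open>A \<le> t\<close>, and the fact that isotropic vectors lie in the kernel.
\<close>

lemma psd_quadratic:
  assumes "psd A"
  shows "0 \<le> Re (hinner x (A *v x)) - 2 * s * (norm (A *v x))\<^sup>2
           + s\<^sup>2 * Re (hinner (A *v x) (A *v (A *v x)))"
proof -
  let ?y = "A *v x"
  have 1: "hinner ?y ?y = of_real ((norm ?y)\<^sup>2)" by (rule hinner_self)
  then have 2: "hinner x (A *v ?y) = of_real ((norm ?y)\<^sup>2)"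
    by (subst psd_hermitian[OF assms]) simp
  have "0 \<le> Re (hinner (x - of_real s *s ?y) (A *v (x - of_real s *s ?y)))"
    by (rule psdD(1)[OF assms])
  then show ?thesis
    by (simp add: matrix_vector_mult_diff_distrib vector_scalar_commute hinner_simps 1 2
        power2_eq_square algebra_simps)
qed

lemma psd_norm_image_le:
  assumes "psd A" "t > 0" "\<And>x. Re (hinner x (A *v x)) \<le> t * (norm x)\<^sup>2"
  shows "(norm (A *v x))\<^sup>2 \<le> t * Re (hinner x (A *v x))"
proof -
  have "0 \<le> Re (hinner x (A *v x)) - 2 * (1/t) * (norm (A *v x))\<^sup>2 + (1/t)\<^sup>2 * (t * (norm (A *v x))\<^sup>2)"
    using psd_quadratic[OF assms(1), of x "1/t"] assms(3)[of "A *v x"]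
    by (smt (verit) mult_left_mono zero_le_power2)
  then show ?thesis using \<open>t > 0\<close> by (simp add: field_simps power2_eq_square)
qed

lemma psd_kernel:
  assumes "psd A" "Re (hinner x (A *v x)) = 0"
  shows "A *v x = 0"
proof (rule ccontr)
  define N where "N = (norm (A *v x))\<^sup>2"
  define b where "b = Re (hinner (A *v x) (A *v (A *v x)))"
  assume "A *v x \<noteq> 0"
  then have N: "N > 0" by (simp add: N_def)
  have b: "b \<ge> 0" using psdD(1)[OF assms(1)] by (simp add: b_def)
  define s where "s = N / (b + 1)"
  have s: "s > 0" "s * b \<le> N" using N b by (auto simp: s_def field_simps)
  have "0 \<le> - 2 * s * N + s\<^sup>2 * b"
    using psd_quadratic[OF assms(1), of x s] assms(2) by (simp add: N_def b_def)
  also have "s\<^sup>2 * b = s * (s * b)" by (simp add: power2_eq_square)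
  also have "\<dots> \<le> s * N" using s by simp
  finally have "s * N \<le> 0" by (simp add: mult.commute)
  moreover have "s * N > 0" using s(1) N by simp
  ultimately show False by linarith
qed

text \<open>
  Put \<open>w = Bv\<close>.  Pairing \<open>ABv = ev\<close> with \<open>w\<close> gives \<open>\<langle>w, Aw\<rangle> = e \<langle>v, Bv\<rangle>\<close>, which determines \<open>e\<close> as a
  quotient of nonnegative reals unless \<open>\<langle>v, Bv\<rangle> = 0\<close>; in that case \<open>Bv = 0\<close> and hence \<open>e = 0\<close>.
\<close>

lemma psd_mult_eigenvalue:
  assumes A: "psd A" and B: "psd B" and v: "v \<noteq> 0" "(A ** B) *v v = e *s v"
  shows "e \<in> \<real>\<^sub>\<ge>\<^sub>0"
proof (cases "Re (hinner v (B *v v)) = 0")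
  case True
  then have "e *s v = 0"
    using psd_kernel[OF B, of v] v(2) by (simp flip: matrix_vector_mul_assoc)
  with v(1) show ?thesis by (auto simp: vec_eq_iff)
next
  case False
  define b where "b = Re (hinner v (B *v v))"
  have b: "b > 0" using False psdD(1)[OF B, of v] by (simp add: b_def)
  have "hinner (B *v v) (A *v (B *v v)) = e * hinner (B *v v) v"
    using v(2) by (simp add: matrix_vector_mul_assoc hinner_simps)
  also have "hinner (B *v v) v = of_real b"
    using psdD(2)[OF B, of v] by (subst hinner_commute) (simp add: b_def complex_eq_iff)
  finally have "e = of_real (inverse b) * hinner (B *v v) (A *v (B *v v))"
    using b by (simp add: field_simps)
  then show ?thesis
    using b psdD[OF A] by (simp add: complex_nonneg_Reals_iff)
qed

lemma psd_mult_eigenvalue_list: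
  fixes A B :: "complex ^ 'n ^ 'n"
  assumes "psd A" "psd B"
  obtains rs :: "real list" where "length rs = CARD('n)" "det (A ** B) = of_real (prod_list rs)"
    "trace (A ** B) = of_real (sum_list rs)" "\<And>r. r \<in> set rs \<Longrightarrow> r \<ge> 0"
    "\<And>r. r \<in> set rs \<Longrightarrow> \<exists>v. v \<noteq> 0 \<and> (A ** B) *v v = of_real r *s v"
proof -
  obtain es where es: "length es = CARD('n)" "det (A ** B) = prod_list es" "trace (A ** B) = sum_list es"
    "\<And>e. e \<in> set es \<Longrightarrow> \<exists>v. v \<noteq> 0 \<and> (A ** B) *v v = e *s v"
    using eigenvalue_list[of "A ** B"] by blast
  have nn: "e \<in> \<real>\<^sub>\<ge>\<^sub>0" if "e \<in> set es" for e
    using es(4)[OF that] psd_mult_eigenvalue[OF assms] by blast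
  define rs where "rs = map Re es"
  have es_rs: "es = map of_real rs"
    using nn by (auto simp: rs_def complex_nonneg_Reals_iff complex_eq_iff o_def intro!: map_idI[symmetric])
  have p: "prod_list (map of_real xs) = (of_real (prod_list xs) :: complex)"
    and s: "sum_list (map of_real xs) = (of_real (sum_list xs) :: complex)" for xs
    by (induction xs) auto
  show ?thesis
  proof
    show "length rs = CARD('n)" using es(1) by (simp add: rs_def)
    show "det (A ** B) = of_real (prod_list rs)" using es(2) p es_rs by simp
    show "trace (A ** B) = of_real (sum_list rs)" using es(3) s es_rs by simp
    show "r \<ge> 0" if "r \<in> set rs" for r
      using that nn by (auto simp: rs_def complex_nonneg_Reals_iff)
    show "\<exists>v. v \<noteq> 0 \<and> (A ** B) *v v = of_real r *s v" if "r \<in> set rs" for r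
      using that es(4) by (simp add: es_rs)
  qed
qed

lemma psd_trace_mult_nonneg:
  assumes "psd A" "psd B"
  shows "0 \<le> Re (trace (A ** B))"
proof -
  obtain rs where "trace (A ** B) = of_real (sum_list rs)" "\<And>r. r \<in> set rs \<Longrightarrow> r \<ge> 0"
    using psd_mult_eigenvalue_list[OF assms] by metis
  then show ?thesis by (simp add: sum_list_nonneg)
qed

text \<open>
  The inequality between the geometric and the arithmetic mean of the eigenvalues of \<open>AB\<close>.
\<close>

lemma psd_mult_am_gm:
  fixes A B :: "complex ^ 'n ^ 'n"
  assumes "psd A" "psd B"
  shows "root CARD('n) (Re (det (A ** B))) \<le> Re (trace (A ** B)) / CARD('n)"
proof -
  let ?n = "CARD('n)"
  obtain rs where rs: "length rs = ?n" "det (A ** B) = of_real (prod_list rs)"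
    "trace (A ** B) = of_real (sum_list rs)" "\<And>r. r \<in> set rs \<Longrightarrow> r \<ge> 0"
    using psd_mult_eigenvalue_list[OF assms] by metis
  have P: "prod_list rs = (\<Prod>i<?n. rs ! i)"
    by (simp add: prod.list_conv_set_nth rs(1) lessThan_atLeast0)
  have S: "sum_list rs = (\<Sum>i<?n. rs ! i)"
    by (simp add: sum_list_sum_nth rs(1) lessThan_atLeast0)
  have nn: "rs ! i \<ge> 0" if "i < ?n" for i using rs(1,4) that by simp
  have "root ?n p = p powr (1 / ?n)" if "p \<ge> 0" for p
    using that by (cases "p = 0") (auto simp: root_powr_inverse)
  moreover have "prod_list rs \<ge> 0"
    unfolding P using nn by (intro prod_nonneg) auto
  ultimately have "root ?n (prod_list rs) = prod_list rs powr (1 / ?n)" by blast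
  also have "\<dots> \<le> (\<Sum>i<?n. rs ! i / ?n)"
    using arith_geom_mean[of "{..<?n}" "\<lambda>i. rs ! i"] nn unfolding P
    by (auto simp: lessThan_empty_iff)
  also have "\<dots> = sum_list rs / ?n" by (simp add: S sum_divide_distrib)
  finally show ?thesis by (simp add: rs)
qed

lemma trace_mat_mult: "trace (mat c ** Q) = c * trace (Q :: complex ^ 'n ^ 'n)"
  by (simp add: trace_def matrix_matrix_mult_def mat_def if_distrib if_distribR sum_distrib_left
      cong: if_cong)

lemma mat_mult_vec: "mat c *v x = c *s (x :: complex ^ 'n)"
  by (simp add: vec_eq_iff matrix_vector_mult_def mat_def if_distrib if_distribR cong: if_cong)

lemma trace_diff_mult: "trace ((A - B) ** Q) = trace (A ** Q) - trace (B ** (Q :: complex ^ 'n ^ 'n))"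
  by (simp add: trace_def matrix_matrix_mult_def algebra_simps sum_subtractf)

text \<open>
  Together with the next lemma: bounds \<open>c \<le> A\<close> and \<open>A \<le> c\<close> in the sense of forms may be inserted into
  the trace of a product, because the product with the positive semidefinite difference has
  nonnegative trace.
\<close>

lemma psd_trace_mult_ge:
  assumes "psd A" "psd Q" "\<And>x. c * (norm x)\<^sup>2 \<le> Re (hinner x (A *v x))"
  shows "c * Re (trace Q) \<le> Re (trace (A ** Q))"
proof -
  have "psd (A - mat (of_real c))"
    using assms psdD(2)[OF assms(1)]
    by (auto simp: psd_def complex_nonneg_Reals_iff matrix_vector_mult_diff_rdistrib hinner_simps
        mat_mult_vec hinner_self simp flip: of_real_power of_real_mult)
  from psd_trace_mult_nonneg[OF this assms(2)] show ?thesis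
    by (simp add: trace_diff_mult trace_mat_mult)
qed

lemma psd_trace_mult_le:
  assumes "psd A" "psd Q" "\<And>x. Re (hinner x (A *v x)) \<le> c * (norm x)\<^sup>2"
  shows "Re (trace (A ** Q)) \<le> c * Re (trace Q)"
proof -
  have "psd (mat (of_real c) - A)"
    using assms psdD(2)[OF assms(1)]
    by (auto simp: psd_def complex_nonneg_Reals_iff matrix_vector_mult_diff_rdistrib hinner_simps
        mat_mult_vec hinner_self simp flip: of_real_power of_real_mult)
  from psd_trace_mult_nonneg[OF this assms(2)] show ?thesis
    by (simp add: trace_diff_mult trace_mat_mult)
qed

text \<open>
  The trace of the product of \<open>H\<close> with the positive semidefinite matrix \<open>|x|\<^sup>2 - x x\<^sup>*\<close> is the difference
  of the two sides.
\<close>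

lemma psd_form_le_trace:
  fixes H :: "complex ^ 'n ^ 'n"
  assumes H: "psd H"
  shows "Re (hinner x (H *v x)) \<le> Re (trace H) * (norm x)\<^sup>2"
proof -
  define R :: "complex ^ 'n ^ 'n" where "R = mat (of_real ((norm x)\<^sup>2)) - (\<chi> i j. x $ i * cnj (x $ j))"
  have Rv: "R *v y = of_real ((norm x)\<^sup>2) *s y - hinner x y *s x" for y
    unfolding R_def matrix_vector_mult_diff_rdistrib mat_mult_vec
    by (simp add: vec_eq_iff matrix_vector_mult_def hinner_def sum_distrib_left sum_distrib_right mult_ac)
  have "hinner y (R *v y) = of_real ((norm x)\<^sup>2 * (norm y)\<^sup>2 - (norm (hinner x y))\<^sup>2)" for y
    unfolding Rv hinner_simps hinner_self
    by (subst (2) hinner_commute) (simp add: complex_norm_square del: of_real_power)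
  moreover have "(norm (hinner x y))\<^sup>2 \<le> (norm x)\<^sup>2 * (norm y)\<^sup>2" for y
    using power_mono[OF norm_hinner_le, of x y 2] by (simp add: power_mult_distrib)
  ultimately have "psd R" by (simp add: psd_def del: of_real_diff of_real_mult)
  have "trace (R ** H) = of_real ((norm x)\<^sup>2) * trace H - hinner x (H *v x)"
    unfolding R_def trace_diff_mult trace_mat_mult
    by (simp add: trace_def matrix_matrix_mult_def matrix_vector_mult_def hinner_def sum_distrib_left mult_ac)
      (subst sum.swap, rule refl)
  with psd_trace_mult_nonneg[OF \<open>psd R\<close> H] show ?thesis by (simp add: mult.commute)
qed

context
  fixes H G :: "complex ^ 'n ^ 'n"
  assumes H: "psd H" and HG: "H ** G = mat 1"
begin

lemma psd_inverse_form: "hinner x (G *v x) = of_real (Re (hinner (G *v x) (H *v (G *v x))))"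
proof -
  have "x = H *v (G *v x)" by (simp add: matrix_vector_mul_assoc HG)
  then have "hinner x (G *v x) = cnj (hinner (G *v x) (H *v (G *v x)))"
    by (metis hinner_commute)
  then show ?thesis
    using psd_form_eq_Re[OF H, of "G *v x"] by (metis complex_cnj_complex_of_real)
qed

lemma psd_inverse: "psd G"
  unfolding psd_def using psd_inverse_form psdD(1)[OF H] by (metis nonneg_Reals_of_real_iff)

text \<open>
  With \<open>y = Gx\<close> the claim reads \<open>|Hy|\<^sup>2 \<le> t \<langle>y, Hy\<rangle>\<close>.
\<close>

lemma psd_inverse_ge:
  assumes "t > 0" "\<And>x. Re (hinner x (H *v x)) \<le> t * (norm x)\<^sup>2"
  shows "(1 / t) * (norm x)\<^sup>2 \<le> Re (hinner x (G *v x))"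
proof -
  have "(norm (H *v (G *v x)))\<^sup>2 \<le> t * Re (hinner (G *v x) (H *v (G *v x)))"
    by (rule psd_norm_image_le[OF H assms])
  also have "H *v (G *v x) = x" by (simp add: matrix_vector_mul_assoc HG)
  also have "Re (hinner (G *v x) x) = Re (hinner x (G *v x))"
    by (subst hinner_commute) simp
  finally show ?thesis using \<open>t > 0\<close> by (simp add: field_simps)
qed

text \<open>
  The numbers \<open>t r\<close>, for \<open>r\<close> an eigenvalue of the inverse \<open>G\<close>, are at least \<open>1\<close>, so each of them is at most
  their product \<open>t\<^sup>n / det H\<close>.
\<close>

lemma psd_inverse_trace_le:
  fixes t :: real
  assumes t: "t > 0" "\<And>x. Re (hinner x (H *v x)) \<le> t * (norm x)\<^sup>2"
  shows "t * Re (trace G) \<le> CARD('n) * t ^ CARD('n) / Re (det H)"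
proof -
  let ?n = "CARD('n)"
  have "psd (mat 1 :: complex ^ 'n ^ 'n)"
    by (simp add: psd_def hinner_self del: of_real_power)
  then obtain rs where rs: "length rs = ?n" "det G = of_real (prod_list rs)"
    "trace G = of_real (sum_list rs)"
    and ev: "\<And>r. r \<in> set rs \<Longrightarrow> \<exists>v. v \<noteq> 0 \<and> G *v v = of_real r *s v"
    using psd_mult_eigenvalue_list[OF psd_inverse, of "mat 1"] by (metis matrix_mul_rid)
  have ge: "1 \<le> t * r" if r: "r \<in> set rs" for r :: real
  proof -
    obtain v where v: "v \<noteq> 0" "G *v v = of_real r *s v" using ev[OF r] by blast
    have "(1 / t) * (norm v)\<^sup>2 \<le> r * (norm v)\<^sup>2"
      using psd_inverse_ge[OF t, of v] by (simp add: v(2) hinner_simps hinner_self flip: of_real_power)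
    then show ?thesis using v(1) t(1) by (simp add: field_simps)
  qed
  have gen: "(\<forall>x\<in>set xs. x \<le> prod_list xs) \<and> 1 \<le> prod_list xs" if "\<forall>x\<in>set xs. 1 \<le> x" for xs :: "real list"
    using that
  proof (induction xs)
    case (Cons a xs)
    then have IH: "\<forall>x\<in>set xs. x \<le> prod_list xs" "1 \<le> prod_list xs" "1 \<le> a" by auto
    have "x \<le> a * prod_list xs" if "x \<in> set xs" for x
      using IH that by (smt (verit) mult_le_cancel_right1)
    moreover have "a \<le> a * prod_list xs" using IH by simp
    ultimately show ?case using IH mult_mono[of 1 a 1 "prod_list xs"] by auto
  qed simp
  have prod: "prod_list (map ((*) t) xs) = t ^ length xs * prod_list xs" for xs
    by (induction xs) (auto simp: mult_ac)
  have "det H * det G = 1" using HG by (metis det_I det_mul)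
  then have "prod_list rs * Re (det H) = 1"
    by (simp add: rs(2) complex_eq_iff mult.commute)
  then have dG: "prod_list rs = 1 / Re (det H)"
    by (metis eq_divide_imp mult_zero_right zero_neq_one)
  have "t * r \<le> t ^ ?n / Re (det H)" if "r \<in> set rs" for r
    using gen[of "map ((*) t) rs"] ge that by (auto simp: prod rs(1) dG)
  then have "sum_list (map ((*) t) rs) \<le> sum_list (map (\<lambda>_. t ^ ?n / Re (det H)) rs)"
    by (intro sum_list_mono) auto
  then show ?thesis by (simp add: rs sum_list_const_mult sum_list_triv)
qed

end

section \<open>Second order behaviour of a twice differentiable function\<close>

lemma nonpos_if_le_all_multiples:
  fixes x N :: real
  assumes "N \<ge> 0" "\<And>\<epsilon>. \<epsilon> > 0 \<Longrightarrow> x \<le> \<epsilon> * N"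
  shows "x \<le> 0"
proof (rule ccontr)
  assume "\<not> x \<le> 0"
  then have x: "x > 0" by simp
  have "x \<le> x / (N + 1) * N" using x assms(1) by (intro assms(2)) simp
  then show False using x assms(1) by (simp add: field_simps)
qed

text \<open>
  The integral over a circle of a quadratic expansion: first order terms and the mixed second order
  term average out.
\<close>

lemma circle_integral:
  fixes g1 g2 b1 b2 b3 c r :: real
  shows "((\<lambda>t. r * (cos t * g1 + sin t * g2)
            + r\<^sup>2 * (cos t ^ 2 * b1 + cos t * sin t * b2 + sin t ^ 2 * b3) + c)
         has_integral (r\<^sup>2 * pi * (b1 + b3) + 2 * pi * c)) {0..2*pi}"
proof -
  define F where "F t = r * (sin t * g1 - cos t * g2) + r\<^sup>2 * ((t + sin t * cos t) / 2 * b1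
     + sin t ^ 2 / 2 * b2 + (t - sin t * cos t) / 2 * b3) + c * t" for t
  have "(F has_real_derivative (r * (cos t * g1 + sin t * g2)
            + r\<^sup>2 * (cos t ^ 2 * b1 + cos t * sin t * b2 + sin t ^ 2 * b3) + c)) (at t)" for t
  proof -
    have 1: "(1 + (cos t * cos t - sin t * sin t)) / 2 = cos t ^ 2"
      "(1 - (cos t * cos t - sin t * sin t)) / 2 = sin t ^ 2"
      using sin_cos_squared_add[of t] by (simp_all add: power2_eq_square)
    show ?thesis unfolding F_def 1[symmetric]
      by (auto intro!: derivative_eq_intros simp: field_simps)
  qed
  then have "((\<lambda>t. r * (cos t * g1 + sin t * g2)
            + r\<^sup>2 * (cos t ^ 2 * b1 + cos t * sin t * b2 + sin t ^ 2 * b3) + c)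
         has_integral (F (2*pi) - F 0)) {0..2*pi}"
    by (intro fundamental_theorem_of_calculus)
      (auto simp: has_real_derivative_iff_has_vector_derivative[symmetric] intro: has_field_derivative_at_within)
  also have "F (2*pi) - F 0 = r\<^sup>2 * pi * (b1 + b3) + 2 * pi * c"
    by (simp add: F_def algebra_simps)
  finally show ?thesis .
qed

text \<open>
  \<open>G x\<close> is the derivative of \<open>u\<close> at \<open>x\<close>, and \<open>B\<close> is the derivative of \<open>G\<close> at the single point \<open>a\<close>, with
  the first argument of \<open>B\<close> being the direction in which \<open>G\<close> is differentiated.  Differentiability of
  \<open>G\<close> at one point suffices for the second order expansion and for the symmetry of \<open>B\<close>.
\<close>

locale twice_differentiable_at =
  fixes u :: "'a::real_normed_vector \<Rightarrow> real" and G B :: "'a \<Rightarrow> 'a \<Rightarrow> real" and S a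
  assumes open_S: "open S" and a_in: "a \<in> S"
    and deriv: "\<And>x. x \<in> S \<Longrightarrow> (u has_derivative G x) (at x)"
    and bilinear_B: "bilinear B"
    and deriv2: "\<And>\<epsilon>. \<epsilon> > 0 \<Longrightarrow> \<exists>\<delta>>0. \<forall>h k. norm h < \<delta> \<longrightarrow>
                   \<bar>G (a + h) k - G a k - B h k\<bar> \<le> \<epsilon> * norm h * norm k"
begin

lemma B_simps:
  "B (x + y) z = B x z + B y z" "B z (x + y) = B z x + B z y"
  "B (c *\<^sub>R x) y = c * B x y" "B x (c *\<^sub>R y) = c * B x y"
  using bilinear_ladd[OF bilinear_B] bilinear_radd[OF bilinear_B]
    bilinear_lmul[OF bilinear_B] bilinear_rmul[OF bilinear_B] by auto

lemma line_deriv: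
  assumes "c + t *\<^sub>R h \<in> S"
  shows "((\<lambda>t. u (c + t *\<^sub>R h)) has_real_derivative G (c + t *\<^sub>R h) h) (at t)"
proof -
  have "((\<lambda>t. c + t *\<^sub>R h) has_derivative (\<lambda>s. s *\<^sub>R h)) (at t)"
    by (auto intro!: derivative_eq_intros)
  then have "((\<lambda>t. u (c + t *\<^sub>R h)) has_derivative (\<lambda>s. G (c + t *\<^sub>R h) (s *\<^sub>R h))) (at t)"
    by (rule has_derivative_compose) (rule deriv[OF assms])
  then show ?thesis
    by (rule has_derivative_imp_has_field_derivative)
      (simp add: linear_scale[OF has_derivative_linear[OF deriv[OF assms]]])
qed

lemma radius:
  assumes "\<epsilon> > 0"
  obtains \<delta> where "\<delta> > 0" "\<And>h. norm h < \<delta> \<Longrightarrow> a + h \<in> S"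
    "\<And>h k. norm h < \<delta> \<Longrightarrow> \<bar>G (a + h) k - G a k - B h k\<bar> \<le> \<epsilon> * norm h * norm k"
proof -
  obtain d where d: "d > 0" "ball a d \<subseteq> S" using open_S a_in openE by blast
  obtain e where e: "e > 0" "\<And>h k. norm h < e \<Longrightarrow> \<bar>G (a + h) k - G a k - B h k\<bar> \<le> \<epsilon> * norm h * norm k"
    using deriv2[OF assms] by blast
  have "a + h \<in> S" if "norm h < d" for h using d(2) that by (auto simp: dist_norm subset_iff)
  then show ?thesis using d(1) e by (intro that[of "min d e"]) auto
qed

text \<open>
  The mean value theorem for \<open>t \<mapsto> u(a + th) - t G(a)h - t\<^sup>2 B(h,h)/2\<close> on \<open>[0,1]\<close>, whose derivative
  is the error of the linear approximation of \<open>G\<close>.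
\<close>

lemma taylor2:
  assumes "\<epsilon> > 0"
  shows "\<exists>\<delta>>0. \<forall>h. norm h < \<delta> \<longrightarrow>
           a + h \<in> S \<and> \<bar>u (a + h) - u a - G a h - B h h / 2\<bar> \<le> \<epsilon> * (norm h)\<^sup>2"
proof -
  obtain \<delta> where \<delta>: "\<delta> > 0" "\<And>h. norm h < \<delta> \<Longrightarrow> a + h \<in> S"
    "\<And>h k. norm h < \<delta> \<Longrightarrow> \<bar>G (a + h) k - G a k - B h k\<bar> \<le> \<epsilon> * norm h * norm k"
    using radius[OF assms] by blast
  have "\<bar>u (a + h) - u a - G a h - B h h / 2\<bar> \<le> \<epsilon> * (norm h)\<^sup>2" if h: "norm h < \<delta>" for h
  proof -
    define \<phi> where "\<phi> t = u (a + t *\<^sub>R h) - t * G a h - t\<^sup>2 * (B h h / 2)" for t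
    have nt: "norm (t *\<^sub>R h) < \<delta>" if "0 \<le> t" "t \<le> 1" for t
      using h that mult_left_le_one_le[of "norm h" t] by simp
    have "(\<phi> has_real_derivative (G (a + t *\<^sub>R h) h - G a h - B (t *\<^sub>R h) h)) (at t)"
      if "0 \<le> t" "t \<le> 1" for t
      unfolding \<phi>_def by (auto intro!: derivative_eq_intros line_deriv \<delta>(2) nt that simp: B_simps)
    from MVT2[of 0 1 \<phi>, OF _ this] obtain t where t: "0 < t" "t < 1"
      "\<phi> 1 - \<phi> 0 = G (a + t *\<^sub>R h) h - G a h - B (t *\<^sub>R h) h" by auto
    have "\<bar>\<phi> 1 - \<phi> 0\<bar> \<le> \<epsilon> * norm (t *\<^sub>R h) * norm h"
      unfolding t(3) using t by (intro \<delta>(3) nt) auto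
    also have "\<dots> = t * (\<epsilon> * (norm h)\<^sup>2)" using t by (simp add: power2_eq_square)
    also have "\<dots> \<le> \<epsilon> * (norm h)\<^sup>2" using t assms by (intro mult_left_le_one_le) auto
    finally show ?thesis by (simp add: \<phi>_def algebra_simps)
  qed
  with \<delta>(1,2) show ?thesis by blast
qed

text \<open>
  The mean value theorem for \<open>t \<mapsto> u(a + k + th) - u(a + th)\<close>.  The left-hand side without \<open>B\<close> is
  symmetric in \<open>h\<close> and \<open>k\<close>, which forces the symmetry of \<open>B\<close>.
\<close>

lemma second_difference:
  assumes \<epsilon>: "\<epsilon> > 0"
    and \<delta>: "\<And>h. norm h < \<delta> \<Longrightarrow> a + h \<in> S"
      "\<And>h k. norm h < \<delta> \<Longrightarrow> \<bar>G (a + h) k - G a k - B h k\<bar> \<le> \<epsilon> * norm h * norm k"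
    and hk: "norm h + norm k < \<delta>"
  shows "\<bar>u (a + h + k) - u (a + h) - u (a + k) + u a - B k h\<bar> \<le> 2 * \<epsilon> * (norm h + norm k)\<^sup>2"
proof -
  define \<psi> where "\<psi> t = u (a + k + t *\<^sub>R h) - u (a + t *\<^sub>R h) - t * B k h" for t
  have n1: "norm (t *\<^sub>R h) \<le> norm h" if "0 \<le> t" "t \<le> 1" for t
    using that mult_left_le_one_le[of "norm h" t] by simp
  have n2: "norm (k + t *\<^sub>R h) \<le> norm h + norm k" if "0 \<le> t" "t \<le> 1" for t
    using n1[OF that] norm_triangle_ineq[of k "t *\<^sub>R h"] by simp
  have n3: "norm (t *\<^sub>R h) < \<delta>" "norm (k + t *\<^sub>R h) < \<delta>" if "0 \<le> t" "t \<le> 1" for t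
    using n1[OF that] n2[OF that] hk norm_ge_zero[of k] by linarith+
  have "(\<psi> has_real_derivative (G (a + (k + t *\<^sub>R h)) h - G (a + t *\<^sub>R h) h - B k h)) (at t)"
    if "0 \<le> t" "t \<le> 1" for t
    using line_deriv[of "a + k" t h] line_deriv[of a t h] \<delta>(1)[OF n3(2)[OF that]] \<delta>(1)[OF n3(1)[OF that]]
    unfolding \<psi>_def add.assoc by (auto intro!: derivative_eq_intros)
  from MVT2[of 0 1 \<psi>, OF _ this] obtain t where t: "0 < t" "t < 1"
    "\<psi> 1 - \<psi> 0 = G (a + (k + t *\<^sub>R h)) h - G (a + t *\<^sub>R h) h - B k h" by auto
  let ?X = "G (a + (k + t *\<^sub>R h)) h - G a h - B (k + t *\<^sub>R h) h"
  let ?Y = "G (a + t *\<^sub>R h) h - G a h - B (t *\<^sub>R h) h"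
  have "\<psi> 1 - \<psi> 0 = ?X - ?Y" using t(3) by (simp add: B_simps)
  moreover have "\<bar>?X\<bar> \<le> \<epsilon> * norm (k + t *\<^sub>R h) * norm h" using t by (intro \<delta>(2) n3) auto
  moreover have "\<bar>?Y\<bar> \<le> \<epsilon> * norm (t *\<^sub>R h) * norm h" using t by (intro \<delta>(2) n3) auto
  moreover have "\<epsilon> * norm (k + t *\<^sub>R h) * norm h \<le> \<epsilon> * (norm h + norm k) * (norm h + norm k)"
    using t \<epsilon> n2[of t] by (intro mult_mono) auto
  moreover have "\<epsilon> * norm (t *\<^sub>R h) * norm h \<le> \<epsilon> * (norm h + norm k) * (norm h + norm k)"
    using t \<epsilon> n1[of t] by (intro mult_mono) (auto intro: order_trans)
  ultimately have "\<bar>\<psi> 1 - \<psi> 0\<bar> \<le> 2 * (\<epsilon> * (norm h + norm k) * (norm h + norm k))" by linarith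
  then show ?thesis by (simp add: \<psi>_def power2_eq_square algebra_simps)
qed

text \<open>
  The error in \<open>second_difference\<close> is quadratic in \<open>(h, k)\<close>, as is \<open>B\<close>; scaling \<open>h\<close> and \<open>k\<close> into the
  ball where the estimate holds therefore costs nothing, and \<open>\<epsilon>\<close> is arbitrary.
\<close>

lemma B_commute: "B h k = B k h"
proof -
  define N where "N = (norm h + norm k)\<^sup>2"
  have le: "\<bar>B h k - B k h\<bar> \<le> \<epsilon> * (4 * N)" if \<epsilon>: "\<epsilon> > 0" for \<epsilon>
  proof -
    obtain \<delta> where \<delta>: "\<delta> > 0" "\<And>h. norm h < \<delta> \<Longrightarrow> a + h \<in> S"
      "\<And>h k. norm h < \<delta> \<Longrightarrow> \<bar>G (a + h) k - G a k - B h k\<bar> \<le> \<epsilon> * norm h * norm k"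
      using radius[OF \<epsilon>] by blast
    \<comment> \<open>A scale that brings both directions within distance \<open>\<delta>\<close>; the summand 1 covers \<open>h = k = 0\<close>.\<close>
    define s where "s = \<delta> / (norm h + norm k + 1)"
    have s: "s > 0" using \<delta>(1) by (simp add: s_def add_nonneg_pos)
    have "norm h + norm k + 1 > 0" by (simp add: add_nonneg_pos)
    then have "s * (norm h + norm k + 1) = \<delta>" by (simp add: s_def)
    then have small: "norm (s *\<^sub>R h) + norm (s *\<^sub>R k) < \<delta>"
      using s by (simp add: algebra_simps)
    have nn: "(norm (s *\<^sub>R h) + norm (s *\<^sub>R k))\<^sup>2 = s\<^sup>2 * N"
      using s by (simp add: N_def power_mult_distrib flip: distrib_left)
    have sd: "\<bar>u (a + h + k) - u (a + h) - u (a + k) + u a - B k h\<bar> \<le> 2 * \<epsilon> * (norm h + norm k)\<^sup>2"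
      if "norm h + norm k < \<delta>" for h k
      by (rule second_difference[OF \<epsilon> _ _ that]) (auto intro: \<delta>)
    have Bs: "B (s *\<^sub>R x) (s *\<^sub>R y) = s\<^sup>2 * B x y" for x y
      by (simp add: B_simps power2_eq_square)
    define X where "X = u (a + s *\<^sub>R h + s *\<^sub>R k) - u (a + s *\<^sub>R h) - u (a + s *\<^sub>R k) + u a"
    have "\<bar>X - s\<^sup>2 * B k h\<bar> \<le> 2 * \<epsilon> * (s\<^sup>2 * N)"
      using sd[OF small] unfolding nn Bs X_def .
    moreover have "\<bar>X - s\<^sup>2 * B h k\<bar> \<le> 2 * \<epsilon> * (s\<^sup>2 * N)"
      using sd[of "s *\<^sub>R k" "s *\<^sub>R h"] small nn unfolding Bs X_def by (simp add: add_ac)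
    ultimately have "\<bar>s\<^sup>2 * B h k - s\<^sup>2 * B k h\<bar> \<le> 4 * \<epsilon> * (s\<^sup>2 * N)" by linarith
    then have "\<bar>s\<^sup>2 * (B h k - B k h)\<bar> \<le> 4 * \<epsilon> * (s\<^sup>2 * N)"
      by (simp add: right_diff_distrib)
    then have "s\<^sup>2 * \<bar>B h k - B k h\<bar> \<le> s\<^sup>2 * (\<epsilon> * (4 * N))"
      by (simp add: abs_mult mult_ac)
    then show ?thesis using s by simp
  qed
  have "\<bar>B h k - B k h\<bar> \<le> 0"
    by (rule nonpos_if_le_all_multiples[OF _ le]) (auto simp: N_def)
  then show ?thesis by simp
qed

text \<open>
  For small \<open>r\<close> the mean of \<open>u\<close> over the ellipse exceeds \<open>u(a)\<close> by
  \<open>(r\<^sup>2/4) (B(v,v) + B(w,w)) + o(r\<^sup>2)\<close>.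
\<close>

lemma mean_value_imp_nonneg:
  assumes mean: "\<exists>r0>0. \<forall>r. 0 < r \<and> r < r0 \<longrightarrow>
      (\<lambda>t. u (a + r *\<^sub>R (cos t *\<^sub>R v + sin t *\<^sub>R w))) integrable_on {0..2*pi} \<and>
      2 * pi * u a \<le> integral {0..2*pi} (\<lambda>t. u (a + r *\<^sub>R (cos t *\<^sub>R v + sin t *\<^sub>R w)))"
  shows "0 \<le> B v v + B w w"
proof -
  define K where "K = norm v + norm w"
  have K: "norm (cos t *\<^sub>R v + sin t *\<^sub>R w) \<le> K" for t
    unfolding K_def
    by (rule norm_triangle_le) (auto intro!: add_mono mult_left_le_one_le)
  have "- (B v v + B w w) \<le> \<epsilon> * (4 * K\<^sup>2)" if \<epsilon>: "\<epsilon> > 0" for \<epsilon>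
  proof -
    obtain r0 where r0: "r0 > 0" "\<And>r. 0 < r \<Longrightarrow> r < r0 \<Longrightarrow>
      (\<lambda>t. u (a + r *\<^sub>R (cos t *\<^sub>R v + sin t *\<^sub>R w))) integrable_on {0..2*pi} \<and>
      2 * pi * u a \<le> integral {0..2*pi} (\<lambda>t. u (a + r *\<^sub>R (cos t *\<^sub>R v + sin t *\<^sub>R w)))"
      using mean by blast
    obtain \<delta> where \<delta>: "\<delta> > 0" "\<And>h. norm h < \<delta> \<Longrightarrow>
        \<bar>u (a + h) - u a - G a h - B h h / 2\<bar> \<le> \<epsilon> * (norm h)\<^sup>2"
      using taylor2[OF \<epsilon>] by blast
    have "0 \<le> K" by (simp add: K_def)
    define r where "r = min (r0 / 2) (\<delta> / (K + 1))"
    have r: "0 < r" "r < r0" using r0(1) \<delta>(1) \<open>0 \<le> K\<close> by (auto simp: r_def)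
    have "r * K < \<delta>"
    proof -
      have "r \<le> \<delta> / (K + 1)" by (simp add: r_def)
      then have "r * (K + 1) \<le> \<delta>" using \<open>0 \<le> K\<close> by (simp add: field_simps)
      then show ?thesis using r by (simp add: algebra_simps)
    qed
    define f where "f t = u (a + r *\<^sub>R (cos t *\<^sub>R v + sin t *\<^sub>R w))" for t
    define g where "g t = r * (cos t * G a v + sin t * G a w)
            + r\<^sup>2 * (cos t ^ 2 * (B v v / 2) + cos t * sin t * ((B v w + B w v) / 2) + sin t ^ 2 * (B w w / 2))
            + (u a + \<epsilon> * r\<^sup>2 * K\<^sup>2)" for t
    have fg: "f t \<le> g t" for t
    proof -
      define h where "h = r *\<^sub>R (cos t *\<^sub>R v + sin t *\<^sub>R w)"
      have nh: "norm h \<le> r * K" using K[of t] r by (simp add: h_def)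
      have lin: "linear (G a)" using has_derivative_linear[OF deriv[OF a_in]] .
      have Gh: "G a h = r * (cos t * G a v + sin t * G a w)"
        by (simp add: h_def linear_add[OF lin] linear_scale[OF lin])
      have Bh: "B h h / 2 = r\<^sup>2 * (cos t ^ 2 * (B v v / 2) + cos t * sin t * ((B v w + B w v) / 2) + sin t ^ 2 * (B w w / 2))"
        by (simp add: h_def B_simps power2_eq_square algebra_simps)
      have "u (a + h) \<le> u a + G a h + B h h / 2 + \<epsilon> * (norm h)\<^sup>2"
        using \<delta>(2)[of h] nh \<open>r * K < \<delta>\<close> by linarith
      also have "\<epsilon> * (norm h)\<^sup>2 \<le> \<epsilon> * (r * K)\<^sup>2"
        using \<epsilon> nh by (intro mult_left_mono power_mono) auto
      finally show ?thesis
        unfolding f_def g_def h_def[symmetric] Gh[symmetric] Bh[symmetric] by (simp add: power_mult_distrib)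
    qed
    have gi: "(g has_integral (r\<^sup>2 * pi * (B v v / 2 + B w w / 2) + 2 * pi * (u a + \<epsilon> * r\<^sup>2 * K\<^sup>2))) {0..2*pi}"
      unfolding g_def[abs_def] by (rule circle_integral)
    have "2 * pi * u a \<le> integral {0..2*pi} f"
      using r0(2)[OF r] by (simp add: f_def[abs_def])
    also have "\<dots> \<le> integral {0..2*pi} g"
      using r0(2)[OF r] gi fg by (intro integral_le) (auto simp: f_def[abs_def])
    also have "\<dots> = r\<^sup>2 * pi * (B v v / 2 + B w w / 2) + 2 * pi * (u a + \<epsilon> * r\<^sup>2 * K\<^sup>2)"
      using gi by blast
    finally have "0 \<le> (r\<^sup>2 * pi / 2) * (B v v + B w w + \<epsilon> * (4 * K\<^sup>2))"
      by (simp add: algebra_simps)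
    then have "0 \<le> B v v + B w w + \<epsilon> * (4 * K\<^sup>2)"
      using r(1) by (meson mult_pos_neg not_less half_gt_zero mult_pos_pos pi_gt_zero zero_less_power)
    then show ?thesis by simp
  qed
  then have "- (B v v + B w w) \<le> 0"
    by (rule nonpos_if_le_all_multiples[rotated]) auto
  then show ?thesis by simp
qed

end

section \<open>Real and complex Hessians\<close>

lemma sum_UNIV_Plus:
  "(\<Sum>a\<in>UNIV. f a) = (\<Sum>j\<in>UNIV. f (Inl j)) + (\<Sum>j\<in>UNIV. f (Inr j))"
  for f :: "'m::finite + 'n::finite \<Rightarrow> 'b::comm_monoid_add"
  by (subst UNIV_Plus_UNIV[symmetric], subst sum.Plus) simp_all

definition real_vec :: "complex ^ 'n \<Rightarrow> real ^ ('n + 'n::finite)" where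
  "real_vec w = (\<chi> a. case a of Inl j \<Rightarrow> Re (w $ j) | Inr j \<Rightarrow> Im (w $ j))"

text \<open>
  Half of the part of \<open>M\<close> that commutes with the complex structure, read as a complex matrix.  The
  normalization and the order of the indices are those of the complex Hessian.
\<close>

definition hermitian_part :: "real ^ ('n + 'n) ^ ('n + 'n) \<Rightarrow> complex ^ 'n ^ 'n::finite" where
  "hermitian_part M = (\<chi> k j. Complex (M $ Inl j $ Inl k + M $ Inr j $ Inr k)
                                      (M $ Inl j $ Inr k - M $ Inr j $ Inl k) / 4)"

lemma real_vec_nth [simp]: "real_vec w $ Inl j = Re (w $ j)" "real_vec w $ Inr j = Im (w $ j)"
  by (simp_all add: real_vec_def)

lemma linear_real_vec: "linear real_vec"
  by (rule linearI) (auto simp: vec_eq_iff real_vec_def split: sum.splits)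

lemma abs_real_vec_le: "\<bar>real_vec w $ a\<bar> \<le> norm w"
  by (cases a) (auto intro: order_trans[OF abs_Re_le_cmod] order_trans[OF abs_Im_le_cmod] Finite_Cartesian_Product.norm_nth_le)

lemma real_vec_real_coord: "real_vec (real_coord a) = axis a 1"
  by (auto simp: vec_eq_iff real_vec_def real_coord_def axis_def split: sum.splits)

text \<open>
  The vectors \<open>real_coord a\<close> are the real basis with respect to which \<open>real_vec\<close> gives coordinates.
\<close>

lemma real_coord_expansion: "(w :: complex ^ 'n::finite) = (\<Sum>a\<in>UNIV. real_vec w $ a *\<^sub>R real_coord a)"
proof -
  have "(\<Sum>a\<in>UNIV. real_vec w $ a *\<^sub>R real_coord a) $ i = w $ i" for i
  proof -
    have "(\<Sum>a\<in>UNIV. real_vec w $ a *\<^sub>R real_coord a) $ i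
        = (\<Sum>j\<in>UNIV. if j = i then of_real (Re (w $ i)) else 0) + (\<Sum>j\<in>UNIV. if j = i then of_real (Im (w $ i)) * \<i> else 0)"
      unfolding sum_UNIV_Plus vector_add_component sum_component vector_scaleR_component real_coord_def
      by (rule arg_cong2[where f="(+)"]; rule sum.cong) (simp_all add: axis_def scaleR_conv_of_real)
    also have "\<dots> = of_real (Re (w $ i)) + of_real (Im (w $ i)) * \<i>" by simp
    also have "\<dots> = w $ i" by (simp add: complex_eq_iff)
    finally show ?thesis .
  qed
  then show ?thesis unfolding vec_eq_iff by metis
qed

lemma has_derivative_partial_sum:
  assumes "(g has_derivative g') (at x)"
  shows "g' k = (\<Sum>a\<in>UNIV. real_vec k $ a *\<^sub>R partial a g x)"
proof -
  have g': "frechet_derivative g (at x) = g'"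
    using assms by (metis frechet_derivative_at)
  have lin: "linear g'" using assms by (rule has_derivative_linear)
  have "g' k = g' (\<Sum>a\<in>UNIV. real_vec k $ a *\<^sub>R real_coord a)"
    using real_coord_expansion[of k] by simp
  also have "\<dots> = (\<Sum>a\<in>UNIV. real_vec k $ a *\<^sub>R g' (real_coord a))"
    by (simp add: linear_sum[OF lin] linear_scale[OF lin])
  finally show ?thesis by (simp add: partial_def g')
qed

text \<open>
  The derivative of \<open>u\<close> is the sum of its partial derivatives weighted by the coordinates of the
  direction, so the finitely many linear approximations of the partial derivatives add up to one of
  the derivative.
\<close>

lemma C2_on_twice_differentiable:
  fixes u :: "complex ^ 'n::finite \<Rightarrow> real"
  assumes S: "open S" and z: "z \<in> S" and C2: "C2_on S u"
  shows "twice_differentiable_at u (\<lambda>x. frechet_derivative u (at x))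
           (\<lambda>h k. real_vec h \<bullet> (real_hessian u z *v real_vec k)) S z"
proof
  show "open S" "z \<in> S" by fact+
  have du: "(u has_derivative frechet_derivative u (at x)) (at x)" if "x \<in> S" for x
    using C2 that by (auto simp: C2_on_def frechet_derivative_works)
  then show "(u has_derivative frechet_derivative u (at x)) (at x)" if "x \<in> S" for x
    using that .
  show "bilinear (\<lambda>h k. real_vec h \<bullet> (real_hessian u z *v real_vec k))"
    unfolding bilinear_def
    by (auto intro!: linearI simp: linear_add[OF linear_real_vec] linear_scale[OF linear_real_vec]
        inner_add_left inner_add_right matrix_vector_right_distrib matrix_vector_mult_scaleR)
  fix \<epsilon> :: real assume \<epsilon>: "\<epsilon> > 0"
  define N where "N = real CARD('n + 'n)"
  have N: "N > 0" by (simp add: N_def)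
  define D where "D b = frechet_derivative (partial b u) (at z)" for b
  have dp: "(partial b u has_derivative D b) (at z)" for b
    using C2 z unfolding D_def by (auto simp: C2_on_def frechet_derivative_works)
  have Dh: "D b h = (\<Sum>a\<in>UNIV. real_vec h $ a * real_hessian u z $ a $ b)" for b h
    using has_derivative_partial_sum[OF dp] by (simp add: real_hessian_def)
  have Bh: "real_vec h \<bullet> (real_hessian u z *v real_vec k) = (\<Sum>b\<in>UNIV. real_vec k $ b * D b h)" for h k
    unfolding Dh inner_vec_def matrix_vector_mult_def
    by (simp add: sum_distrib_left mult_ac) (rule sum.swap)
  have "\<forall>b. \<exists>d>0. \<forall>y. norm (y - z) < d \<longrightarrow>
      norm (partial b u y - partial b u z - D b (y - z)) \<le> (\<epsilon> / N) * norm (y - z)"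
    using dp \<epsilon> N unfolding has_derivative_at_alt by (meson divide_pos_pos)
  then obtain d where d: "\<And>b. d b > 0" "\<And>b y. norm (y - z) < d b \<Longrightarrow>
      norm (partial b u y - partial b u z - D b (y - z)) \<le> (\<epsilon> / N) * norm (y - z)"
    by metis
  obtain d0 where d0: "d0 > 0" "ball z d0 \<subseteq> S" using S z openE by blast
  define \<delta> where "\<delta> = Min (insert d0 (range d))"
  have \<delta>: "\<delta> > 0" using d(1) d0(1) by (auto simp: \<delta>_def)
  have \<delta>_le: "\<delta> \<le> d0" "\<delta> \<le> d b" for b
    unfolding \<delta>_def by (rule Min_le; simp)+
  have "\<bar>frechet_derivative u (at (z + h)) k - frechet_derivative u (at z) k
      - real_vec h \<bullet> (real_hessian u z *v real_vec k)\<bar> \<le> \<epsilon> * norm h * norm k"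
    if h: "norm h < \<delta>" for h k
  proof -
    have "z + h \<in> S" using h \<delta>_le(1) d0(2) by (auto simp: subset_iff dist_norm)
    have e: "\<bar>partial b u (z + h) - partial b u z - D b h\<bar> \<le> \<epsilon> / N * norm h" for b
      using d(2)[of "z + h" b] h \<delta>_le(2)[of b] by simp
    have "frechet_derivative u (at (z + h)) k - frechet_derivative u (at z) k
      - real_vec h \<bullet> (real_hessian u z *v real_vec k)
      = (\<Sum>b\<in>UNIV. real_vec k $ b * (partial b u (z + h) - partial b u z - D b h))"
      using has_derivative_partial_sum[OF du[OF \<open>z + h \<in> S\<close>], of k] has_derivative_partial_sum[OF du[OF z], of k]
      by (simp add: Bh sum_subtractf sum.distrib algebra_simps)
    also have "\<bar>\<dots>\<bar> \<le> (\<Sum>b\<in>(UNIV :: ('n + 'n) set). norm k * (\<epsilon> / N * norm h))"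
      by (rule order_trans[OF sum_abs], rule sum_mono, unfold abs_mult, rule mult_mono)
        (rule abs_real_vec_le, rule e, simp_all)
    also have "\<dots> = \<epsilon> * norm h * norm k" by (simp add: N_def)
    finally show ?thesis .
  qed
  with \<delta> show "\<exists>\<delta>>0. \<forall>h k. norm h < \<delta> \<longrightarrow>
      \<bar>frechet_derivative u (at (z + h)) k - frechet_derivative u (at z) k
        - real_vec h \<bullet> (real_hessian u z *v real_vec k)\<bar> \<le> \<epsilon> * norm h * norm k" by blast
qed

lemma real_hessian_symmetric:
  assumes "open S" "z \<in> S" "C2_on S u"
  shows "real_hessian u z \<in> Sym"
proof -
  interpret twice_differentiable_at u "\<lambda>x. frechet_derivative u (at x)"
    "\<lambda>h k. real_vec h \<bullet> (real_hessian u z *v real_vec k)" S z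
    by (rule C2_on_twice_differentiable[OF assms])
  have "real_hessian u z $ a $ b = real_hessian u z $ b $ a" for a b
    using B_commute[of "real_coord a" "real_coord b"]
    by (simp add: real_vec_real_coord inner_axis' matrix_vector_mul_component inner_axis)
  then show ?thesis by (simp add: Sym_def transpose_def vec_eq_iff)
qed

lemma partial_eqI: "(g has_derivative g') (at z) \<Longrightarrow> partial a g z = g' (real_coord a)"
  unfolding partial_def by (metis frechet_derivative_at)

lemma complex_hessian_eq:
  assumes S: "open S" "z \<in> S" and C2: "C2_on S u"
  shows "complex_hessian u z = hermitian_part (real_hessian u z)"
proof -
  have du: "(u has_derivative frechet_derivative u (at x)) (at x)" if "x \<in> S" for x
    using C2 that by (auto simp: C2_on_def frechet_derivative_works)
  have dp: "(partial b u has_derivative frechet_derivative (partial b u) (at z)) (at z)" for b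
    using C2 S(2) by (auto simp: C2_on_def frechet_derivative_works)
  let ?cu = "\<lambda>w. complex_of_real (u w)"
  have pc: "partial a ?cu x = of_real (partial a u x)" if "x \<in> S" for a x
    using partial_eqI[OF has_derivative_of_real[OF du[OF that]]] by (simp add: partial_def)
  have pz: "partial a (d_zbar k ?cu) z = (of_real (partial a (partial (Inl k) u) z)
          + \<i> * of_real (partial a (partial (Inr k) u) z)) / 2" for a k
  proof -
    have "((\<lambda>x. (of_real (partial (Inl k) u x) + \<i> * of_real (partial (Inr k) u x)) / 2) has_derivative
       (\<lambda>h. (of_real (frechet_derivative (partial (Inl k) u) (at z) h)
          + \<i> * of_real (frechet_derivative (partial (Inr k) u) (at z) h)) / 2)) (at z)"
      by (auto intro!: derivative_eq_intros dp simp: fun_eq_iff)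
    then have "(d_zbar k ?cu has_derivative
       (\<lambda>h. (of_real (frechet_derivative (partial (Inl k) u) (at z) h)
          + \<i> * of_real (frechet_derivative (partial (Inr k) u) (at z) h)) / 2)) (at z)"
      by (rule has_derivative_transform_within_open[OF _ S]) (simp add: d_zbar_def pc)
    from partial_eqI[OF this] show ?thesis by (simp add: partial_def)
  qed
  show ?thesis
    unfolding complex_hessian_def hermitian_part_def d_z_def pz
    by (simp add: vec_eq_iff real_hessian_def complex_eq_iff field_simps)
qed

text \<open>
  The form of the complex matrix at \<open>w\<close> averages the real form over \<open>w\<close> and \<open>\<i>w\<close>.  The symmetry of \<open>M\<close>
  makes the imaginary part of the double sum antisymmetric under exchange of the two indices.
\<close>

lemma hermitian_part_form:
  assumes "M \<in> Sym"
  shows "hinner w (hermitian_part M *v w) =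
    of_real ((real_vec w \<bullet> (M *v real_vec w) + real_vec (\<i> *s w) \<bullet> (M *v real_vec (\<i> *s w))) / 4)"
proof -
  have sym: "M $ a $ b = M $ b $ a" for a b
    using assms by (metis (mono_tags) Sym_def mem_Collect_eq transpose_def vec_lambda_beta)
  let ?p = "\<lambda>j. Re (w $ j)" and ?q = "\<lambda>j. Im (w $ j)"
  define R where "R j k = M $ Inl j $ Inl k + M $ Inr j $ Inr k" for j k
  define I where "I j k = M $ Inl j $ Inr k - M $ Inr j $ Inl k" for j k
  have "hinner w (hermitian_part M *v w)
      = (\<Sum>k\<in>UNIV. \<Sum>j\<in>UNIV. cnj (w $ k) * (Complex (R j k) (I j k) / 4) * w $ j)"
    by (simp add: hinner_def matrix_vector_mult_def hermitian_part_def R_def I_def sum_distrib_left mult_ac)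
  then have Re: "Re (hinner w (hermitian_part M *v w))
      = (\<Sum>k\<in>UNIV. \<Sum>j\<in>UNIV. (R j k * (?p k * ?p j + ?q k * ?q j) - I j k * (?p k * ?q j - ?q k * ?p j)) / 4)"
    and Im: "Im (hinner w (hermitian_part M *v w))
      = (\<Sum>k\<in>UNIV. \<Sum>j\<in>UNIV. (R j k * (?p k * ?q j - ?q k * ?p j) + I j k * (?p k * ?p j + ?q k * ?q j)) / 4)"
    by (simp_all add: algebra_simps add_divide_distrib diff_divide_distrib)
  let ?X = "\<lambda>k j. (R j k * (?p k * ?q j - ?q k * ?p j) + I j k * (?p k * ?p j + ?q k * ?q j)) / 4"
  have X: "?X k j = - ?X j k" for k j
    unfolding R_def I_def
    by (simp add: sym[of "Inl j" "Inl k"] sym[of "Inr j" "Inr k"] sym[of "Inl j" "Inr k"] sym[of "Inr j" "Inl k"] field_simps)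
  define s where "s = (\<Sum>k\<in>UNIV. \<Sum>j\<in>UNIV. ?X k j)"
  have "s = (\<Sum>k\<in>UNIV. \<Sum>j\<in>UNIV. - ?X j k)"
    unfolding s_def by (intro sum.cong refl X)
  also have "\<dots> = - (\<Sum>k\<in>UNIV. \<Sum>j\<in>UNIV. ?X j k)" by (simp only: sum_negf)
  also have "(\<Sum>k\<in>UNIV. \<Sum>j\<in>UNIV. ?X j k) = s" unfolding s_def by (rule sum.swap)
  finally have "s = 0" by simp
  then have Im0: "Im (hinner w (hermitian_part M *v w)) = 0" unfolding Im s_def .
  have q: "v \<bullet> (M *v v) = (\<Sum>k\<in>UNIV. \<Sum>j\<in>UNIV. v $ Inl j * M $ Inl j $ Inl k * v $ Inl k
      + v $ Inl j * M $ Inl j $ Inr k * v $ Inr k + v $ Inr j * M $ Inr j $ Inl k * v $ Inl k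
      + v $ Inr j * M $ Inr j $ Inr k * v $ Inr k)" for v
    unfolding inner_vec_def matrix_vector_mult_def
    by (subst sum.swap) (simp add: sum_UNIV_Plus sum.distrib sum_distrib_left distrib_left mult_ac add_ac)
  have "Re (hinner w (hermitian_part M *v w)) =
      (real_vec w \<bullet> (M *v real_vec w) + real_vec (\<i> *s w) \<bullet> (M *v real_vec (\<i> *s w))) / 4"
    unfolding Re q sum.distrib[symmetric] sum_divide_distrib
    by (intro sum.cong refl) (simp add: R_def I_def algebra_simps)
  with Im0 show ?thesis by (simp add: complex_eq_iff)
qed

lemma trace_hermitian_part: "Re (trace (hermitian_part M)) = trace M / 4"
  by (simp add: trace_def hermitian_part_def sum_UNIV_Plus sum.distrib flip: sum_divide_distrib)

lemma hermitian_part_add: "hermitian_part (M + N) = hermitian_part M + hermitian_part N"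
  and hermitian_part_scaleR: "hermitian_part (c *\<^sub>R M) = c *\<^sub>R hermitian_part M"
  by (simp_all add: vec_eq_iff hermitian_part_def complex_eq_iff field_simps)

lemma psd_hermitian_part:
  assumes "P \<in> Sym" "pos_semidef P"
  shows "psd (hermitian_part P)"
  using assms(2) by (simp add: psd_def hermitian_part_form[OF assms(1)] pos_semidef_def del: of_real_divide of_real_add)

text \<open>
  On the complex line through \<open>z\<close> in direction \<open>w\<close>, the circles of the sub-mean value inequality are the
  circles spanned by the real directions \<open>w\<close> and \<open>\<i>w\<close>.
\<close>

lemma plurisubharmonic_imp_psd:
  fixes u :: "complex ^ 'n::finite \<Rightarrow> real"
  assumes S: "open S" "z \<in> S" and C2: "C2_on S u" and psh: "plurisubharmonic_on S u"
  shows "psd (hermitian_part (real_hessian u z))"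
  unfolding psd_def
proof
  fix w
  let ?B = "\<lambda>h k. real_vec h \<bullet> (real_hessian u z *v real_vec k)"
  interpret twice_differentiable_at u "\<lambda>x. frechet_derivative u (at x)" ?B S z
    by (rule C2_on_twice_differentiable[OF S C2])
  obtain d where d: "d > 0" "ball z d \<subseteq> S" using S openE by blast
  have "0 \<le> ?B w w + ?B (\<i> *s w) (\<i> *s w)"
  proof (rule mean_value_imp_nonneg, intro exI conjI allI impI; (elim conjE)?)
    show "d / (norm w + 1) > 0" using d(1) by (simp add: add_nonneg_pos)
    fix r assume r: "0 < r" "r < d / (norm w + 1)"
    have circ: "z + cis t *s (of_real r *s w) = z + r *\<^sub>R (cos t *\<^sub>R w + sin t *\<^sub>R (\<i> *s w))" for t
      by (simp add: vec_eq_iff complex_eq_iff algebra_simps)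
    have "z + \<zeta> *s (of_real r *s w) \<in> S" if "norm \<zeta> \<le> 1" for \<zeta>
    proof -
      have "norm (\<zeta> *s (of_real r *s w)) = norm \<zeta> * r * norm w"
        using r by (simp add: norm_vec_def L2_set_def norm_mult power_mult_distrib sum_distrib_left[symmetric] real_sqrt_mult mult_ac)
      also have "\<dots> \<le> r * norm w" using that r by (simp add: mult_left_le_one_le mult_right_mono)
      also have "\<dots> < d"
        using r norm_ge_zero[of w] by (simp add: pos_less_divide_eq add_nonneg_pos algebra_simps)
      finally show ?thesis using d(2) by (auto simp: subset_iff dist_norm)
    qed
    then have "(\<lambda>t. u (z + cis t *s (of_real r *s w))) absolutely_integrable_on {0..2 * pi}"
      "u z \<le> (1 / (2 * pi)) * integral {0..2 * pi} (\<lambda>t. u (z + cis t *s (of_real r *s w)))"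
      using psh unfolding plurisubharmonic_on_def by blast+
    then show "(\<lambda>t. u (z + r *\<^sub>R (cos t *\<^sub>R w + sin t *\<^sub>R (\<i> *s w)))) integrable_on {0..2*pi}"
      "2 * pi * u z \<le> integral {0..2*pi} (\<lambda>t. u (z + r *\<^sub>R (cos t *\<^sub>R w + sin t *\<^sub>R (\<i> *s w))))"
      unfolding circ by (auto simp: set_lebesgue_integral_eq_integral field_simps)
  qed
  then show "hinner w (hermitian_part (real_hessian u z) *v w) \<in> \<real>\<^sub>\<ge>\<^sub>0"
    by (simp add: hermitian_part_form[OF real_hessian_symmetric[OF S C2]] del: of_real_divide of_real_add)
qed

lemma trace_le_onorm:
  fixes P :: "real ^ 'm ^ 'm::finite"
  shows "trace P \<le> CARD('m) * onorm ((*v) P)"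
proof -
  have "P $ a $ a \<le> onorm ((*v) P)" for a
  proof -
    have "P $ a $ a = axis a 1 \<bullet> (P *v axis a 1)"
      by (simp add: inner_axis' matrix_vector_mul_component inner_axis)
    also have "\<dots> \<le> norm (axis a 1 :: real^'m) * norm (P *v axis a 1)" by (rule norm_cauchy_schwarz)
    also have "\<dots> \<le> onorm ((*v) P)"
      using onorm[OF matrix_vector_mul_bounded_linear, of P "axis a 1"] by simp
    finally show ?thesis .
  qed
  then show ?thesis
    unfolding trace_def using sum_bounded_above[of UNIV "\<lambda>a. P $ a $ a"] by simp
qed

text \<open>
  Positivity of the form at \<open>e\<^sub>a + e\<^sub>b\<close> and \<open>e\<^sub>a - e\<^sub>b\<close> bounds every entry by the trace.
\<close>

lemma pos_semidef_onorm_le_trace: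
  fixes P :: "real ^ 'm ^ 'm::finite"
  assumes "P \<in> Sym" and P: "pos_semidef P"
  shows "onorm ((*v) P) \<le> real CARD('m) * real CARD('m) * trace P"
proof -
  have sym: "P $ a $ b = P $ b $ a" for a b
    using assms(1) by (metis (mono_tags) Sym_def mem_Collect_eq transpose_def vec_lambda_beta)
  have ax: "axis a 1 \<bullet> (P *v axis b 1) = P $ a $ b" for a b
    by (simp add: inner_axis' matrix_vector_mul_component inner_axis)
  have diag: "0 \<le> P $ a $ a" for a
    using P ax[of a a] by (metis pos_semidef_def)
  have tr: "P $ a $ a \<le> trace P" for a
    unfolding trace_def by (rule member_le_sum) (auto simp: diag)
  have "\<bar>P $ a $ b\<bar> \<le> trace P" for a b
  proof -
    have "0 \<le> (axis a 1 + axis b 1) \<bullet> (P *v (axis a 1 + axis b 1))"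
      "0 \<le> (axis a 1 - axis b 1) \<bullet> (P *v (axis a 1 - axis b 1))"
      using P unfolding pos_semidef_def by blast+
    then show ?thesis using tr[of a] tr[of b] sym[of a b]
      by (simp add: matrix_vector_right_distrib matrix_vector_mult_diff_distrib inner_add_left
          inner_add_right inner_diff_left inner_diff_right ax)
  qed
  then show ?thesis by (rule onorm_le_matrix_component)
qed

section \<open>The linearized determinant root\<close>

text \<open>
  The derivative of \<open>det\<^sup>1\<^sup>/\<^sup>n\<close> at \<open>H\<close> in the direction \<open>K\<close>.
\<close>

definition linearization :: "complex ^ 'n ^ 'n \<Rightarrow> complex ^ 'n ^ 'n \<Rightarrow> real" where
  "linearization H K = root CARD('n) (Re (det H)) / CARD('n) * Re (trace (matrix_inv H ** K))"

lemma psd_det_real: "psd H \<Longrightarrow> det H = of_real (Re (det H))"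
  for H :: "complex ^ 'n ^ 'n"
proof -
  assume "psd H"
  moreover have "psd (mat 1 :: complex ^ 'n ^ 'n)"
    by (simp add: psd_def hinner_self del: of_real_power)
  ultimately obtain rs where "det (H ** mat 1) = of_real (prod_list rs)"
    using psd_mult_eigenvalue_list by metis
  then show ?thesis by simp
qed

lemma linearization_add: "linearization H (K + L) = linearization H K + linearization H L"
  by (simp add: linearization_def matrix_add_ldistrib trace_add distrib_left)

lemma linearization_scaleR: "linearization H (c *\<^sub>R K) = c * linearization H K"
  by (simp add: linearization_def trace_def matrix_matrix_mult_def flip: scaleR_sum_right)

context
  fixes H :: "complex ^ 'n ^ 'n"
  assumes H: "psd H" and det_pos: "Re (det H) > 0"
begin

lemma inverse_right: "H ** matrix_inv H = mat 1"
  and inverse_left: "matrix_inv H ** H = mat 1"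
proof -
  have "invertible H" unfolding invertible_det_nz using det_pos by auto
  then show "H ** matrix_inv H = mat 1" "matrix_inv H ** H = mat 1"
    unfolding matrix_inv_def invertible_def by (metis (mono_tags, lifting) someI_ex)+
qed

lemma linearization_self: "linearization H H = root CARD('n) (Re (det H))"
  by (simp add: linearization_def inverse_left trace_I)

text \<open>
  The arithmetic-geometric mean inequality for \<open>H\<inverse>K\<close>, whose determinant is \<open>det K / det H\<close>.
\<close>

lemma root_det_le_linearization:
  assumes K: "psd K"
  shows "root CARD('n) (Re (det K)) \<le> linearization H K"
proof -
  let ?r = "root CARD('n)"
  have "det H * det (matrix_inv H) = 1" using inverse_right by (metis det_I det_mul)
  then have "Re (det H) * Re (det (matrix_inv H)) = 1"
    using psd_det_real[OF H] psd_det_real[OF psd_inverse[OF H inverse_right]]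
    by (metis Re_complex_of_real of_real_mult one_complex.sel(1))
  then have "Re (det K) = Re (det H) * Re (det (matrix_inv H ** K))"
    using psd_det_real[OF K] psd_det_real[OF psd_inverse[OF H inverse_right]]
    by (metis Re_complex_of_real det_mul mult.assoc mult_1 of_real_mult)
  then have "?r (Re (det K)) = ?r (Re (det H)) * ?r (Re (det (matrix_inv H ** K)))"
    by (simp add: real_root_mult)
  also have "\<dots> \<le> ?r (Re (det H)) * (Re (trace (matrix_inv H ** K)) / CARD('n))"
    using psd_mult_am_gm[OF psd_inverse[OF H inverse_right] K] det_pos
    by (intro mult_left_mono) auto
  finally show ?thesis by (simp add: linearization_def)
qed

context
  fixes T lam :: real
  assumes T: "T > 0" "Re (trace H) \<le> T" and lam: "lam > 0" "lam \<le> root CARD('n) (Re (det H))"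
begin

lemma form_le: "Re (hinner x (H *v x)) \<le> T * (norm x)\<^sup>2"
  using psd_form_le_trace[OF H, of x] T(2)
  by (meson mult_right_mono order_trans zero_le_power2)

lemma linearization_ge_trace:
  assumes Q: "psd Q"
  shows "lam / (CARD('n) * T) * Re (trace Q) \<le> linearization H Q"
proof -
  have tr: "0 \<le> Re (trace Q)"
    using psd_trace_mult_ge[of "mat 1" Q 0] Q
    by (simp add: psd_def hinner_self del: of_real_power)
  have "1 / T * Re (trace Q) \<le> Re (trace (matrix_inv H ** Q))"
    by (rule psd_trace_mult_ge[OF psd_inverse[OF H inverse_right] Q])
      (rule psd_inverse_ge[OF H inverse_right T(1) form_le])
  then have "lam / CARD('n) * (1 / T * Re (trace Q))
      \<le> root CARD('n) (Re (det H)) / CARD('n) * Re (trace (matrix_inv H ** Q))"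
    using lam T(1) tr det_pos by (intro mult_mono divide_right_mono divide_nonneg_nonneg) auto
  then show ?thesis by (simp add: linearization_def)
qed

text \<open>
  Here \<open>det(H)\<^sup>1\<^sup>/\<^sup>n \<le> T\<close> by the arithmetic-geometric mean inequality, and \<open>tr(H\<inverse>)\<close> bounds
  \<open>H\<inverse>\<close> and is itself controlled by \<open>psd_inverse_trace_le\<close>.
\<close>

lemma linearization_le_trace:
  assumes Q: "psd Q"
  shows "linearization H Q \<le> (T / lam) ^ CARD('n) * Re (trace Q)"
proof -
  let ?n = "CARD('n)" and ?G = "matrix_inv H"
  define r where "r = root ?n (Re (det H))"
  have r: "0 < r" "lam \<le> r" "Re (det H) = r ^ ?n"
    using lam det_pos by (auto simp: r_def)
  have I: "psd (mat 1 :: complex ^ 'n ^ 'n)"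
    by (simp add: psd_def hinner_self del: of_real_power)
  have tr: "0 \<le> Re (trace Q)"
    using psd_trace_mult_nonneg[OF I Q] by simp
  have trG: "0 \<le> Re (trace ?G)"
    using psd_trace_mult_nonneg[OF I psd_inverse[OF H inverse_right]] by simp
  have "r \<le> Re (trace H) / ?n"
    using psd_mult_am_gm[OF I H] by (simp add: r_def)
  also have "\<dots> \<le> T"
  proof -
    have "1 * T \<le> ?n * T" using T(1) by (intro mult_right_mono) (auto simp: Suc_le_eq)
    then show ?thesis using T(2) by (simp add: pos_divide_le_eq mult.commute)
  qed
  finally have "r \<le> T" .
  have "r * Re (trace ?G) \<le> T * Re (trace ?G)"
    using \<open>r \<le> T\<close> trG by (rule mult_right_mono)
  also have "\<dots> \<le> ?n * T ^ ?n / Re (det H)"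
    by (rule psd_inverse_trace_le[OF H inverse_right T(1) form_le])
  also have "\<dots> \<le> ?n * T ^ ?n / lam ^ ?n"
    unfolding r(3) using r lam(1) T(1) by (intro divide_left_mono power_mono) auto
  finally have *: "r / ?n * Re (trace ?G) \<le> (T / lam) ^ ?n"
    by (simp add: field_simps power_divide)
  have "linearization H Q \<le> r / ?n * (Re (trace ?G) * Re (trace Q))"
    unfolding linearization_def r_def[symmetric]
    using r(1) psd_trace_mult_le[OF psd_inverse[OF H inverse_right] Q
        psd_form_le_trace[OF psd_inverse[OF H inverse_right]]]
    by (intro mult_left_mono) auto
  also have "\<dots> \<le> (T / lam) ^ ?n * Re (trace Q)"
    using mult_right_mono[OF * tr] by (simp add: mult_ac)
  finally show ?thesis .
qed

end
end

section \<open>Infima of elliptic linear functions and the theorem\<close>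

lemma Sym_subspace:
  "M \<in> Sym \<Longrightarrow> N \<in> Sym \<Longrightarrow> M + N \<in> Sym" "M \<in> Sym \<Longrightarrow> c *\<^sub>R M \<in> Sym" "mat c \<in> Sym"
  for M N :: "real ^ 'm ^ 'm::finite"
  by (auto simp: Sym_def transpose_def vec_eq_iff mat_def)

lemma pos_semidef_add_onorm:
  fixes M :: "real ^ 'm ^ 'm::finite"
  shows "pos_semidef (M + onorm ((*v) M) *\<^sub>R mat 1)"
  unfolding pos_semidef_def
proof
  fix x
  have "- (x \<bullet> (M *v x)) \<le> norm x * norm (M *v x)"
    using Cauchy_Schwarz_ineq2[of x "M *v x"] by linarith
  also have "\<dots> \<le> norm x * (onorm ((*v) M) * norm x)"
    by (intro mult_left_mono onorm matrix_vector_mul_bounded_linear) auto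
  finally show "0 \<le> x \<bullet> ((M + onorm ((*v) M) *\<^sub>R mat 1) *v x)"
    by (simp add: matrix_vector_mult_add_rdistrib inner_add_right scaleR_matrix_vector_assoc[symmetric]
        power2_norm_eq_inner[symmetric] power2_eq_square mult_ac)
qed

text \<open>
  By linearity the ellipticity bounds compare \<open>L z (M + P)\<close> with \<open>L z M\<close>, with the same constants for
  all \<open>z\<close>.  They also make the infimum finite: adding a multiple of the identity moves \<open>M\<close> into the
  positive semidefinite matrices, where every \<open>L z\<close> is nonnegative.
\<close>

lemma infimum_of_linear_elliptic:
  fixes L :: "'z \<Rightarrow> real ^ 'm ^ 'm::finite \<Rightarrow> real"
  assumes Z: "Z \<noteq> {}" and \<theta>: "\<theta> > 0"
    and lin: "\<And>z. z \<in> Z \<Longrightarrow> linear (L z)"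
    and lower: "\<And>z P. z \<in> Z \<Longrightarrow> P \<in> Sym \<Longrightarrow> pos_semidef P \<Longrightarrow> \<theta> * onorm ((*v) P) \<le> L z P"
    and upper: "\<And>z P. z \<in> Z \<Longrightarrow> P \<in> Sym \<Longrightarrow> pos_semidef P \<Longrightarrow> L z P \<le> inverse \<theta> * onorm ((*v) P)"
  defines "F \<equiv> \<lambda>M. INF z\<in>Z. L z M"
  shows "concave_on Sym F" "uniformly_elliptic \<theta> F"
proof -
  have bdd: "bdd_below ((\<lambda>z. L z M) ` Z)" if M: "M \<in> Sym" for M
  proof (rule bdd_belowI2)
    fix z assume z: "z \<in> Z"
    let ?c = "onorm ((*v) M)" and ?I = "mat 1 :: real ^ 'm ^ 'm"
    have c: "0 \<le> ?c" by (simp add: onorm_pos_le matrix_vector_mul_bounded_linear)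
    have "0 \<le> \<theta> * onorm ((*v) (M + ?c *\<^sub>R ?I))"
      using \<theta> by (simp add: onorm_pos_le matrix_vector_mul_bounded_linear)
    also have "\<dots> \<le> L z (M + ?c *\<^sub>R ?I)"
      by (intro lower z Sym_subspace M pos_semidef_add_onorm)
    also have "\<dots> = L z M + ?c * L z ?I"
      by (simp add: linear_add[OF lin[OF z]] linear_scale[OF lin[OF z]])
    also have "?c * L z ?I \<le> ?c * (inverse \<theta> * onorm ((*v) ?I))"
      by (intro mult_left_mono upper z Sym_subspace c) (simp add: pos_semidef_def)
    finally show "- (?c * (inverse \<theta> * onorm ((*v) ?I))) \<le> L z M" by linarith
  qed
  have F_le: "F M \<le> L z M" if "M \<in> Sym" "z \<in> Z" for M z
    unfolding F_def by (rule cINF_lower[OF bdd]) (use that in auto)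
  have F_ge: "c \<le> F M" if "\<And>z. z \<in> Z \<Longrightarrow> c \<le> L z M" for c M
    unfolding F_def by (rule cINF_greatest[OF Z that])
  show "concave_on Sym F"
    unfolding concave_on_iff
  proof (intro conjI ballI allI impI)
    show "convex (Sym :: (real ^ 'm ^ 'm) set)"
      unfolding convex_def by (auto intro: Sym_subspace)
    fix M N :: "real ^ 'm ^ 'm" and s t :: real
    assume MN: "M \<in> Sym" "N \<in> Sym" and st: "0 \<le> s" "0 \<le> t" "s + t = 1"
    show "s * F M + t * F N \<le> F (s *\<^sub>R M + t *\<^sub>R N)"
    proof (rule F_ge)
      fix z assume z: "z \<in> Z"
      have "s * F M + t * F N \<le> s * L z M + t * L z N"
        using MN st z by (intro add_mono mult_left_mono F_le) auto
      then show "s * F M + t * F N \<le> L z (s *\<^sub>R M + t *\<^sub>R N)"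
        by (simp add: linear_add[OF lin[OF z]] linear_scale[OF lin[OF z]])
    qed
  qed
  show "uniformly_elliptic \<theta> F"
    unfolding uniformly_elliptic_def
  proof (intro ballI impI conjI)
    fix M P :: "real ^ 'm ^ 'm"
    assume M: "M \<in> Sym" and P: "P \<in> Sym" "pos_semidef P"
    have "F M + \<theta> * onorm ((*v) P) \<le> F (M + P)"
    proof (rule F_ge)
      fix z assume z: "z \<in> Z"
      show "F M + \<theta> * onorm ((*v) P) \<le> L z (M + P)"
        using F_le[OF M z] lower[OF z P] by (simp add: linear_add[OF lin[OF z]])
    qed
    then show "\<theta> * onorm ((*v) P) \<le> F (M + P) - F M" by linarith
    have "F (M + P) - inverse \<theta> * onorm ((*v) P) \<le> F M"
    proof (rule F_ge)
      fix z assume z: "z \<in> Z"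
      show "F (M + P) - inverse \<theta> * onorm ((*v) P) \<le> L z M"
        using F_le[OF Sym_subspace(1)[OF M P(1)] z] upper[OF z P] by (simp add: linear_add[OF lin[OF z]])
    qed
    then show "F (M + P) - F M \<le> inverse \<theta> * onorm ((*v) P)" by linarith
  qed
qed

theorem theorem1p2:
  fixes lam Lam :: real
  assumes "lam > 0"
  shows "\<exists>\<theta>>0. \<forall>(u :: complex ^ 'n::finite \<Rightarrow> real) (f :: complex ^ 'n \<Rightarrow> real).
    C2_on (ball 0 1) u \<longrightarrow>
    plurisubharmonic_on (ball 0 1) u \<longrightarrow>
    (\<forall>z\<in>ball 0 1. det (complex_hessian u z) = complex_of_real (f z)) \<longrightarrow>
    (INF z\<in>ball 0 1. ereal (root CARD('n) (f z))) \<ge> ereal lam \<longrightarrow>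
    (SUP z\<in>ball 0 1. ereal (laplacian u z)) \<le> ereal Lam \<longrightarrow>
    (\<exists>F :: real ^ ('n + 'n) ^ ('n + 'n) \<Rightarrow> real.
       concave_on Sym F \<and>
       uniformly_elliptic \<theta> F \<and>
       (\<forall>z\<in>ball 0 1. F (real_hessian u z) = root CARD('n) (f z)))"
proof -
  define n where "n = real CARD('n)"
  have n: "n > 0" by (simp add: n_def)
  define T where "T = max Lam 1 / 4"
  have T: "T > 0" by (simp add: T_def)
  \<comment> \<open>The bound on the Laplacian is replaced by its maximum with 1 to make \<open>T\<close> positive.
      The factor \<open>16 n\<^sup>3 = n * 4 * (2n)\<^sup>2\<close> collects \<open>1/n\<close> from the linearization, \<open>1/4\<close> from the trace of
      the Hermitian part, and \<open>(2n)\<^sup>2\<close> from the comparison of operator norm and trace; likewise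
      \<open>n/2 = 2n/4\<close> in the upper constant.\<close>
  define c1 where "c1 = lam / (16 * n ^ 3 * T)"
  define c2 where "c2 = (T / lam) ^ CARD('n) * n / 2"
  have c: "c1 > 0" "c2 > 0" using assms n T by (simp_all add: c1_def c2_def)
  define \<theta> where "\<theta> = min c1 (inverse c2)"
  have \<theta>: "\<theta> > 0" "\<theta> \<le> c1" "c2 \<le> inverse \<theta>"
    using c by (auto simp: \<theta>_def min_def le_imp_inverse_le field_simps)
  show ?thesis
  proof (intro exI[of _ \<theta>] conjI \<theta>(1) allI impI)
    fix u f :: "complex ^ 'n \<Rightarrow> real"
    let ?B = "ball 0 1 :: (complex ^ 'n) set"
    assume C2: "C2_on ?B u" and psh: "plurisubharmonic_on ?B u"
      and det: "\<forall>z\<in>?B. det (complex_hessian u z) = complex_of_real (f z)"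
      and inf: "(INF z\<in>?B. ereal (root CARD('n) (f z))) \<ge> ereal lam"
      and sup: "(SUP z\<in>?B. ereal (laplacian u z)) \<le> ereal Lam"
    define H where "H z = hermitian_part (real_hessian u z)" for z
    have sym: "real_hessian u z \<in> Sym" if "z \<in> ?B" for z
      using real_hessian_symmetric[OF open_ball that C2] .
    have H: "psd (H z)" if "z \<in> ?B" for z
      unfolding H_def using plurisubharmonic_imp_psd[OF open_ball that C2 psh] .
    have detH: "Re (det (H z)) = f z" if "z \<in> ?B" for z
      using det[rule_format, OF that] unfolding complex_hessian_eq[OF open_ball that C2] H_def by simp
    have lam_le: "lam \<le> root CARD('n) (f z)" if "z \<in> ?B" for z
      using inf that by (simp add: le_INF_iff)
    have fpos: "f z > 0" if "z \<in> ?B" for z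
    proof -
      have "0 < root CARD('n) (f z)" using lam_le[OF that] assms by linarith
      then show ?thesis by simp
    qed
    have trH: "Re (trace (H z)) \<le> T" if "z \<in> ?B" for z
    proof -
      have "Re (trace (H z)) = laplacian u z / 4"
        unfolding H_def trace_hermitian_part
        by (simp add: trace_def laplacian_def real_hessian_def)
      also have "laplacian u z \<le> Lam" using sup that by (simp add: SUP_le_iff)
      finally show ?thesis by (simp add: T_def)
    qed
    define L where "L z M = linearization (H z) (hermitian_part M)" for z M
    define F where "F = (\<lambda>M. INF z\<in>?B. L z M)"
    have lin: "linear (L z)" for z
      by (rule linearI) (simp_all add: L_def hermitian_part_add hermitian_part_scaleR
          linearization_add linearization_scaleR)
    have lower: "\<theta> * onorm ((*v) P) \<le> L z P"
      and upper: "L z P \<le> inverse \<theta> * onorm ((*v) P)"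
      if z: "z \<in> ?B" and P: "P \<in> Sym" "pos_semidef P" for z P
    proof -
      have on: "0 \<le> onorm ((*v) P)" by (simp add: onorm_pos_le matrix_vector_mul_bounded_linear)
      have dp: "Re (det (H z)) > 0" using fpos[OF z] detH[OF z] by simp
      have ll: "lam \<le> root CARD('n) (Re (det (H z)))" using lam_le[OF z] detH[OF z] by simp
      note Q = psd_hermitian_part[OF P]
      have "\<theta> * onorm ((*v) P) \<le> c1 * onorm ((*v) P)" using \<theta>(2) on by (rule mult_right_mono)
      also have "\<dots> \<le> c1 * (4 * n\<^sup>2 * trace P)"
        using pos_semidef_onorm_le_trace[OF P] c(1) by (simp add: n_def power2_eq_square)
      also have "\<dots> = lam / (n * T) * (trace P / 4)"
        using n T by (simp add: c1_def field_simps power2_eq_square power3_eq_cube)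
      also have "\<dots> \<le> L z P"
        using linearization_ge_trace[OF H[OF z] dp T trH[OF z] assms ll Q]
        by (simp add: L_def n_def trace_hermitian_part)
      finally show "\<theta> * onorm ((*v) P) \<le> L z P" .
      have "L z P \<le> (T / lam) ^ CARD('n) * (trace P / 4)"
        using linearization_le_trace[OF H[OF z] dp T trH[OF z] assms ll Q]
        by (simp add: L_def trace_hermitian_part)
      also have "\<dots> \<le> (T / lam) ^ CARD('n) * (2 * n * onorm ((*v) P) / 4)"
        using trace_le_onorm[of P] T assms
        by (intro mult_left_mono divide_right_mono) (auto simp: n_def)
      also have "\<dots> = c2 * onorm ((*v) P)" by (simp add: c2_def)
      also have "\<dots> \<le> inverse \<theta> * onorm ((*v) P)" using \<theta>(3) on by (rule mult_right_mono)
      finally show "L z P \<le> inverse \<theta> * onorm ((*v) P)" .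
    qed
    have "concave_on Sym F" "uniformly_elliptic \<theta> F"
      unfolding F_def using infimum_of_linear_elliptic[of ?B \<theta> L, OF _ \<theta>(1) lin lower upper] by auto
    moreover have "F (real_hessian u z) = root CARD('n) (f z)" if z: "z \<in> ?B" for z
    proof -
      have self: "L z (real_hessian u z) = root CARD('n) (f z)"
        using linearization_self[OF H[OF z]] fpos[OF z] detH[OF z] by (simp add: L_def flip: H_def)
      have le: "root CARD('n) (f z) \<le> L w (real_hessian u z)" if w: "w \<in> ?B" for w
        using root_det_le_linearization[OF H[OF w] _ H[OF z]] fpos[OF w] detH[OF w] detH[OF z]
        by (simp add: L_def flip: H_def)
      show ?thesis
        unfolding F_def
      proof (rule antisym)
        show "(INF w\<in>?B. L w (real_hessian u z)) \<le> root CARD('n) (f z)"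
          unfolding self[symmetric] by (rule cINF_lower[OF bdd_belowI2[OF le] z])
        show "root CARD('n) (f z) \<le> (INF w\<in>?B. L w (real_hessian u z))"
          using z by (intro cINF_greatest le) auto
      qed
    qed
    ultimately show "\<exists>F :: real ^ ('n + 'n) ^ ('n + 'n) \<Rightarrow> real.
       concave_on Sym F \<and> uniformly_elliptic \<theta> F \<and>
       (\<forall>z\<in>?B. F (real_hessian u z) = root CARD('n) (f z))" by blast
  qed
qed

end
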